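(* Let $n,\ell,t$ be integers with $1\leq t\leq n-2$ and $n+t+2\leq \ell$, and assume $(\ell,q)\neq(n+t+2,2)$ and $(\ell,q)\neq(n+t+3,2)$. If $\mathcal{F}\subseteq{V\brack n,0}$ is a maximal non-trivial $t$-intersecting family and \[|\mathcal{F}|\geq q^{\ell(n-t-1)+1}\theta_{n-t-1}-q^{\ell(n-t-2)+3}{n-t-1\brack 2},\] then one of the following holds: (i) $\mathcal{F}=\mathcal{H}_2(X,M,C)$ for some $(t,0)$-subspace $X$, $(n,k)$-subspace $M$ and $(c,c-n)$-subspace $C$ of $V$ with $X\subseteq M\subseteq C$, where $k\in\{0,1\}$ and $c\in\{n+1,n+2,\ldots,2n-t,n+\ell\}$; (ii) $\mathcal{F}=\mathcal{H}_3(Z)$ for some $(t+2,0)$-subspace $Z$ of $V$, and $\frac{n}{2}-1\leq t\leq n-2$; (iii) $\mathcal{F}=\mathcal{H}_3(Z)$ for some $(t+2,1)$-subspace $Z$ of $V$, and $\frac{n}{2}-\frac{1}{2}\leq t\leq n-2$.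
   Context: Let $q$ be a prime power, $V$ an $(n+\ell)$-dimensional vector space over $\mathbb{F}_q$ and $W$ a fixed $\ell$-dimensional subspace of $V$. A subspace $P$ of $V$ has type $(m,s)$ (is an $(m,s)$-subspace) if $\dim P=m$ and $\dim(P\cap W)=s$. For a subspace $S$ of $V$, ${S\brack m,s}$ denotes the set of all $(m,s)$-subspaces of $V$ contained in $S$. The Gaussian binomial is ${a\brack b}=\prod_{0\le i<b}\frac{q^{a-i}-1}{q^{b-i}-1}$, with ${a\brack 0}=1$ and ${a\brack c}=0$ for $c<0$; $\theta_a={a\brack 1}$. A family $\mathcal{F}\subseteq{V\brack n,0}$ is $t$-intersecting if $\dim(A\cap B)\ge t$ for all $A,B\in\mathcal F$; it is non-trivial if $\dim(\bigcap_{F\in\mathcal F}F)<t$; it is maximal if $\mathcal F\cup\{A\}$ is not $t$-intersecting for every $A\in{V\brack n,0}\setminus\mathcal F$. For a $(t,0)$-subspace $X$, an $(n,k)$-subspace $M$ ($k\in\{0,1\}$) and a $(c,c-n)$-subspace $C$ with $X\subseteq M\subseteq C$, define $\mathcal{H}_2(X,M,C)=\mathcal{A}\cup\mathcal{B}\cup\mathcal{C}$ where $\mathcal{A}=\{F\in{V\brack n,0}: X\subseteq F,\ \dim(F\cap M)\ge t+1\}$, $\mathcal{B}=\{F\in{V\brack n,0}: F\cap M=X,\ \dim(F\cap C)=c-n+t\}$, $\mathcal{C}=\{F\in{C\brack n,0}: \dim(F\cap X)=t-1,\ \dim(F\cap M)=n-1\}$. For a $(t+2,k)$-subspace $Z$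 ($k\in\{0,1\}$), $\mathcal{H}_3(Z)=\{F\in{V\brack n,0}: \dim(F\cap Z)\ge t+1\}$. *)

theory Defs
  imports Complex_Main "HOL-Library.Cardinality"
begin

definition gauss_binom :: "nat \<Rightarrow> int \<Rightarrow> int \<Rightarrow> real" where
  "gauss_binom q a b =
     (if b < 0 then 0
      else \<Prod>i<nat b. (real q powi (a - int i) - 1) / (real q powi (b - int i) - 1))"

definition theta :: "nat \<Rightarrow> int \<Rightarrow> real" where
  "theta q a = gauss_binom q a 1"

text \<open>The ambient space \<open>V\<close> is the whole vector type, i.e. \<^term>\<open>UNIV\<close>; \<open>W\<close> is the
  distinguished subspace with respect to which types of subspaces are measured.\<close>

definition has_type :: "('a::field \<Rightarrow> 'b::ab_group_add \<Rightarrow> 'b) \<Rightarrow> 'b set \<Rightarrow> nat \<Rightarrow> nat \<Rightarrow> 'b set \<Rightarrow> bool" where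
  "has_type scale W m s P \<longleftrightarrow> module.subspace scale P \<and> vector_space.dim scale P = m \<and> vector_space.dim scale (P \<inter> W) = s"

definition typed_subspaces :: "('a::field \<Rightarrow> 'b::ab_group_add \<Rightarrow> 'b) \<Rightarrow> 'b set \<Rightarrow> 'b set \<Rightarrow> nat \<Rightarrow> nat \<Rightarrow> 'b set set" where
  "typed_subspaces scale W S m s = {P. has_type scale W m s P \<and> P \<subseteq> S}"

definition t_intersecting :: "('a::field \<Rightarrow> 'b::ab_group_add \<Rightarrow> 'b) \<Rightarrow> nat \<Rightarrow> 'b set set \<Rightarrow> bool" where
  "t_intersecting scale t \<F> \<longleftrightarrow> (\<forall>A\<in>\<F>. \<forall>B\<in>\<F>. t \<le> vector_space.dim scale (A \<inter> B))"

definition non_trivial :: "('a::field \<Rightarrow> 'b::ab_group_add \<Rightarrow> 'b) \<Rightarrow> nat \<Rightarrow> 'b set set \<Rightarrow> bool" where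
  "non_trivial scale t \<F> \<longleftrightarrow> vector_space.dim scale (\<Inter>\<F>) < t"

definition maximal_family :: "('a::field \<Rightarrow> 'b::ab_group_add \<Rightarrow> 'b) \<Rightarrow> 'b set \<Rightarrow> nat \<Rightarrow> nat \<Rightarrow> 'b set set \<Rightarrow> bool" where
  "maximal_family scale W n t \<F> \<longleftrightarrow>
     (\<forall>A \<in> typed_subspaces scale W UNIV n 0 - \<F>. \<not> t_intersecting scale t (\<F> \<union> {A}))"

text \<open>The parameter \<open>c\<close> of a \<open>(c, c - n)\<close>-subspace \<open>C\<close> is recovered as \<open>dim C\<close>.
  The subtractions on \<^typ>\<open>nat\<close> below are exact for \<open>1 \<le> t\<close>, \<open>1 \<le> n\<close> and \<open>M \<subseteq> C\<close> with
  \<open>dim M = n\<close>.\<close>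

definition H2 :: "('a::field \<Rightarrow> 'b::ab_group_add \<Rightarrow> 'b) \<Rightarrow> 'b set \<Rightarrow> nat \<Rightarrow> nat \<Rightarrow> 'b set \<Rightarrow> 'b set \<Rightarrow> 'b set \<Rightarrow> 'b set set" where
  "H2 scale W n t X M C =
     {F \<in> typed_subspaces scale W UNIV n 0. X \<subseteq> F \<and> t + 1 \<le> vector_space.dim scale (F \<inter> M)}
   \<union> {F \<in> typed_subspaces scale W UNIV n 0. F \<inter> M = X \<and> vector_space.dim scale (F \<inter> C) = vector_space.dim scale C - n + t}
   \<union> {F \<in> typed_subspaces scale W C n 0. vector_space.dim scale (F \<inter> X) = t - 1 \<and> vector_space.dim scale (F \<inter> M) = n - 1}"

definition H3 :: "('a::field \<Rightarrow> 'b::ab_group_add \<Rightarrow> 'b) \<Rightarrow> 'b set \<Rightarrow> nat \<Rightarrow> nat \<Rightarrow> 'b set \<Rightarrow> 'b set set" where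
  "H3 scale W n t Z = {F \<in> typed_subspaces scale W UNIV n 0. t + 1 \<le> vector_space.dim scale (F \<inter> Z)}"

end

theory Submission
  imports Defs
begin

text \<open>
  Call a subspace transversal if it meets \<open>W\<close> trivially, and covering if it is transversal and meets
  every member of \<open>\<F>\<close> in dimension at least \<open>t\<close>. If a transversal \<open>S\<close> of dimension \<open>s \<ge> t\<close> is not
  covering, some \<open>F' \<in> \<F>\<close> has \<open>dim (S \<inter> F') < t\<close>, and every member of \<open>\<F>\<close> above \<open>S\<close> contains one of
  few one-dimensional extensions of \<open>S\<close> inside \<open>S + F'\<close>. Iterating this up to the least dimension of
  a covering subspace gives, when that dimension is at least \<open>t + 2\<close>, a bound below the assumed size;
  it is not \<open>t\<close> because \<open>\<F>\<close> is non-trivial, so it is \<open>t + 1\<close>.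

  By maximality any two covering \<open>(t + 1)\<close>-spaces meet in dimension at least \<open>t\<close>. So either three of
  them have no common \<open>t\<close>-space, and then all of them lie in a \<open>(t + 2)\<close>-space \<open>Z\<close> and \<open>\<F>\<close> is the
  family \<open>H3\<close> of \<open>Z\<close>; or all of them contain a common \<open>t\<close>-space \<open>X\<close>. In the second case they lie in
  the intersection \<open>D\<close> of all \<open>X + F\<close>, where \<open>F \<in> \<F>\<close> does not contain \<open>X\<close>. If \<open>dim D < n\<close> there are
  too few of them for the assumed size; otherwise any \<open>n\<close>-space \<open>M\<close> with \<open>X \<subseteq> M \<subseteq> D\<close> exhibits \<open>\<F>\<close>
  as a family \<open>H2\<close>.
\<close>

section \<open>Numerical estimates\<close>

text \<open>The number of one-dimensional subspaces of a \<open>k\<close>-dimensional space over a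
  field with \<open>x\<close> elements. The real base keeps the estimates free of casts.\<close>

definition proj_points :: "real \<Rightarrow> nat \<Rightarrow> real" where
  "proj_points x k = (x ^ k - 1) / (x - 1)"

text \<open>\<open>gauss_rec x d j\<close> is the Gaussian binomial coefficient of \<open>d + j\<close> over \<open>j\<close> with base \<open>x\<close>.\<close>

fun gauss_rec :: "real \<Rightarrow> nat \<Rightarrow> nat \<Rightarrow> real" where
  "gauss_rec x d 0 = 1"
| "gauss_rec x d (Suc j) = (x ^ (d + Suc j) - 1) / (x ^ Suc j - 1) * gauss_rec x d j"

text \<open>The shape of the bound on \<open>\<F>\<close> when the least covering dimension is
  \<open>t + d\<close>: \<open>t\<close>-subspaces of a covering space, then the factors spent in
  extending one of them dimension by dimension up to \<open>t + d\<close>, then complements of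
  \<open>W\<close> above the result.\<close>

definition cover_bound :: "real \<Rightarrow> nat \<Rightarrow> nat \<Rightarrow> nat \<Rightarrow> nat \<Rightarrow> real" where
  "cover_bound x l n t d =
     gauss_rec x d t * ((\<Prod>j<d. x ^ (j + 1) * proj_points x (n - t - j)) * x ^ (l * (n - t - d)))"

lemma gauss_rec_0:
  assumes "x > 1" shows "gauss_rec x 0 j = 1"
proof (induction j)
  case (Suc j)
  have "x ^ Suc j > 1" using assms by (rule one_less_power) simp
  then show ?case using Suc by simp
qed simp

lemma gauss_rec_nonneg: "x > 1 \<Longrightarrow> gauss_rec x d j \<ge> 0"
proof (induction j)
  case (Suc j)
  have "x ^ Suc j \<ge> 1" "x ^ (d + Suc j) \<ge> 1"
    using Suc.prems by (intro one_le_power; simp)+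
  then show ?case using Suc by (auto intro!: mult_nonneg_nonneg divide_nonneg_nonneg)
qed simp

lemma proj_points_nonneg: "x > 1 \<Longrightarrow> proj_points x k \<ge> 0"
  unfolding proj_points_def by (intro divide_nonneg_nonneg) (auto intro: one_le_power)

text \<open>The defining recursion runs in \<open>j\<close>; comparing cover bounds for successive
  \<open>d\<close> needs the recursion in the other argument.\<close>

lemma gauss_rec_Suc_left:
  assumes "x > 1"
  shows "gauss_rec x (Suc d) j = gauss_rec x d j * ((x ^ (d + Suc j) - 1) / (x ^ Suc d - 1))"
proof (induction j)
  case 0
  have "x ^ Suc d > 1" using assms by (rule one_less_power) simp
  then show ?case by simp
next
  case (Suc j)
  have "x ^ Suc d > 1" "x ^ Suc j > 1" "x ^ (d + Suc j) > 1"
    using assms by (intro one_less_power; simp)+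
  then show ?case using Suc by (simp add: divide_simps)
qed

lemma power_quotient_le:
  fixes x :: real
  assumes "x \<ge> 2" "b \<ge> 1"
  shows "(x ^ (a + b) - 1) / (x ^ b - 1) \<le> x ^ Suc a"
proof -
  have b: "x ^ b > 1" using assms by (intro one_less_power) auto
  have "x ^ Suc a \<le> x ^ (a + b)"
    using assms by (intro power_increasing) auto
  moreover have "x ^ (a + b) * 2 \<le> x ^ (a + b) * x"
    using assms by (intro mult_left_mono) auto
  ultimately have "x ^ (a + b) - 1 \<le> x ^ Suc a * (x ^ b - 1)"
    by (simp add: algebra_simps power_add)
  then show ?thesis using b by (simp add: pos_divide_le_eq)
qed

lemma proj_points_le_power:
  assumes "x \<ge> 2" shows "proj_points x k \<le> x ^ k"
proof -
  have "proj_points x k \<le> x ^ k / (x - 1)"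
    unfolding proj_points_def using assms by (intro divide_right_mono) auto
  also have "\<dots> \<le> x ^ k / 1"
    using assms by (intro divide_left_mono) auto
  finally show ?thesis by simp
qed

text \<open>One more step costs a Gaussian quotient of at most \<open>x ^ (t + 1)\<close> and an
  extension factor of at most \<open>x ^ (d + 1) * x ^ (n - t - d)\<close>, together
  \<open>x ^ (n + 2)\<close>, while a factor \<open>x ^ l\<close> is lost.\<close>

lemma cover_bound_Suc_le:
  assumes x: "x \<ge> 2" and "t + Suc d \<le> n" "n + 2 \<le> l"
  shows "cover_bound x l n t (Suc d) \<le> cover_bound x l n t d"
proof -
  let ?P = "gauss_rec x d t * (\<Prod>j<d. x ^ (j + 1) * proj_points x (n - t - j))"
  have x1: "x > 1" using x by simp
  have P: "?P \<ge> 0"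
    using gauss_rec_nonneg[OF x1] proj_points_nonneg[OF x1] x1
    by (auto intro!: mult_nonneg_nonneg prod_nonneg)
  define k where "k = n - t - d"
  have k: "k \<ge> 1" "n - t - Suc d = k - 1" using assms by (auto simp: k_def)
  have "(x ^ (d + Suc t) - 1) / (x ^ Suc d - 1) * (x ^ (d + 1) * proj_points x k)
      \<le> x ^ Suc t * (x ^ (d + 1) * x ^ k)"
  proof (rule mult_mono)
    show "(x ^ (d + Suc t) - 1) / (x ^ Suc d - 1) \<le> x ^ Suc t"
      using power_quotient_le[OF x, of "Suc d" t] by (simp add: add.commute)
    show "x ^ (d + 1) * proj_points x k \<le> x ^ (d + 1) * x ^ k"
      using proj_points_le_power[OF x] x by (intro mult_left_mono) auto
  qed (use x1 proj_points_nonneg in auto)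
  also have "\<dots> = x ^ (n + 2)"
    using assms by (simp add: k_def flip: power_add power_Suc)
  also have "\<dots> \<le> x ^ l"
    using assms by (intro power_increasing) auto
  finally have r: "(x ^ (d + Suc t) - 1) / (x ^ Suc d - 1) * (x ^ (d + 1) * proj_points x k) \<le> x ^ l" .
  have "cover_bound x l n t (Suc d)
      = ?P * ((x ^ (d + Suc t) - 1) / (x ^ Suc d - 1) * (x ^ (d + 1) * proj_points x k)) * x ^ (l * (k - 1))"
    unfolding cover_bound_def k(2) gauss_rec_Suc_left[OF x1] by (simp add: k_def)
  also have "\<dots> \<le> ?P * x ^ l * x ^ (l * (k - 1))"
    using r P x1 by (intro mult_right_mono mult_left_mono) auto
  also have "\<dots> = cover_bound x l n t d"
  proof -
    have "l * k = l + l * (k - 1)" using k by (cases k) auto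
    then show ?thesis unfolding cover_bound_def k_def[symmetric] by (simp add: power_add)
  qed
  finally show ?thesis .
qed

lemma cover_bound_antimono:
  assumes "x \<ge> 2" "n + 2 \<le> l" "2 \<le> d" "t + d \<le> n"
  shows "cover_bound x l n t d \<le> cover_bound x l n t 2"
  using assms(3,4)
proof (induction d rule: dec_induct)
  case (step d)
  then show ?case using cover_bound_Suc_le[OF assms(1), of t d n l] assms(2) by simp
qed simp

lemma gauss_rec_1: "x > 1 \<Longrightarrow> gauss_rec x 1 t = proj_points x (t + 1)"
  using gauss_rec_Suc_left[of x 0 t] gauss_rec_0[of x t] by (simp add: proj_points_def)

lemma gauss_rec_2:
  "x > 1 \<Longrightarrow> gauss_rec x 2 t = proj_points x (t + 1) * ((x ^ (t + 2) - 1) / (x ^ 2 - 1))"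
  using gauss_rec_Suc_left[of x 1 t] gauss_rec_1[of x t] by (simp add: numeral_2_eq_2)

text \<open>The size threshold of the theorem, with \<open>a = n - t - 1\<close>.\<close>

definition size_threshold :: "real \<Rightarrow> nat \<Rightarrow> nat \<Rightarrow> real" where
  "size_threshold x l a = x ^ (l * a + 1) * proj_points x a
     - x ^ (l * (a - 1) + 3) * (proj_points x a * (x ^ (a - 1) - 1) / (x ^ 2 - 1))"

text \<open>Splits off the factor that the competing bounds share, so that each comparison reduces
  to the remaining factor.\<close>

lemma size_threshold_eq:
  assumes "a \<ge> 1"
  shows "size_threshold x l a =
    x ^ (l * (a - 1)) * proj_points x a * (x * (x ^ l - x ^ 2 * (x ^ (a - 1) - 1) / (x ^ 2 - 1)))"
proof -
  obtain b where "a = Suc b" using assms by (cases a) auto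
  then show ?thesis
    unfolding size_threshold_def by (simp add: power_add algebra_simps power2_eq_square power3_eq_cube)
qed

text \<open>The subtracted term is below \<open>x ^ (n - t) / 3\<close> because
  \<open>x ^ 2 - 1 \<ge> 3\<close>, and \<open>n - t + 4 \<le> l\<close> follows from
  \<open>t \<ge> 1\<close>. So it takes away at most the fraction \<open>1 / (3 * x ^ 4)\<close> of
  \<open>x ^ l\<close>.\<close>

lemma correction_le:
  fixes x :: real
  assumes "x \<ge> 2" "t \<ge> 1" "t + 2 \<le> n" "n + t + 2 \<le> l"
  shows "3 * x ^ 4 * (x ^ 2 * (x ^ (n - t - 2) - 1) / (x ^ 2 - 1)) \<le> x ^ l"
proof -
  have "x ^ 2 \<ge> 2 ^ 2" using assms by (intro power_mono) auto
  then have x2: "x ^ 2 - 1 \<ge> 3" by simp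
  have "x ^ 2 * (x ^ (n - t - 2) - 1) / (x ^ 2 - 1) \<le> x ^ 2 * x ^ (n - t - 2) / 3"
    using x2 assms by (intro frac_le mult_left_mono) auto
  also have "x ^ 2 * x ^ (n - t - 2) = x ^ (2 + (n - t - 2))"
    by (rule power_add[symmetric])
  also have "2 + (n - t - 2) = n - t"
    using assms by simp
  finally have "3 * (x ^ 2 * (x ^ (n - t - 2) - 1) / (x ^ 2 - 1)) \<le> x ^ (n - t)"
    by linarith
  then have "x ^ 4 * (3 * (x ^ 2 * (x ^ (n - t - 2) - 1) / (x ^ 2 - 1))) \<le> x ^ 4 * x ^ (n - t)"
    using assms(1) by (intro mult_left_mono) auto
  also have "\<dots> = x ^ (4 + (n - t))"
    by (simp add: power_add)
  also have "\<dots> \<le> x ^ l"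
    using assms by (intro power_increasing) auto
  finally show ?thesis by (simp only: mult_ac)
qed

lemma proj_points_pos: "x > 1 \<Longrightarrow> k \<ge> 1 \<Longrightarrow> proj_points x k > 0"
  unfolding proj_points_def by (simp add: one_less_power)

lemma less_size_threshold:
  fixes x :: real
  assumes "x \<ge> 2" "t \<ge> 1" "t + 2 \<le> n" "n + t + 2 \<le> l"
    and y: "x ^ 4 * 3 * y < (x ^ 4 * 3 - 1) * (x * x ^ l)"
  shows "x ^ (l * (n - t - 2)) * proj_points x (n - t - 1) * y < size_threshold x l (n - t - 1)"
proof -
  let ?c = "x ^ 2 * (x ^ (n - t - 2) - 1) / (x ^ 2 - 1)"
  have "x * (x ^ 4 * 3 * ?c) \<le> x * x ^ l"
    using correction_le[OF assms(1-4)] assms(1) by (intro mult_left_mono) (auto simp: mult_ac)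
  then have "x ^ 4 * 3 * y < x ^ 4 * 3 * (x * (x ^ l - ?c))"
    using y by (simp add: algebra_simps)
  then have "y < x * (x ^ l - ?c)"
    using assms(1) by simp
  moreover have "x ^ (l * (n - t - 2)) * proj_points x (n - t - 1) > 0"
    using assms proj_points_pos[of x "n - t - 1"] by simp
  ultimately have "x ^ (l * (n - t - 2)) * proj_points x (n - t - 1) * y
      < x ^ (l * (n - t - 2)) * proj_points x (n - t - 1) * (x * (x ^ l - ?c))"
    by (rule mult_strict_left_mono)
  also have "\<dots> = size_threshold x l (n - t - 1)"
    using size_threshold_eq[of "n - t - 1" x l] assms(3) by (simp add: numeral_2_eq_2)
  finally show ?thesis .
qed

text \<open>At \<open>x \<ge> 2\<close> the relative loss \<open>1 / (3 * x ^ 4)\<close> is at most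
  1/48.\<close>

lemma less_size_threshold':
  fixes x :: real
  assumes "x \<ge> 2" "t \<ge> 1" "t + 2 \<le> n" "n + t + 2 \<le> l"
    and y: "48 * y < 47 * (x * x ^ l)"
  shows "x ^ (l * (n - t - 2)) * proj_points x (n - t - 1) * y < size_threshold x l (n - t - 1)"
proof (rule less_size_threshold[OF assms(1-4)])
  have "x ^ 4 \<ge> 2 ^ 4" using assms by (intro power_mono) auto
  then have x4: "x ^ 4 * 3 \<ge> 48" by simp
  have "(x ^ 4 * 3) * (48 * y) < (x ^ 4 * 3) * (47 * (x * x ^ l))"
    using y x4 by (intro mult_strict_left_mono) auto
  moreover have "48 * (x * x ^ l) \<le> (x ^ 4 * 3) * (x * x ^ l)"
    using x4 assms by (intro mult_right_mono) auto
  ultimately show "x ^ 4 * 3 * y < (x ^ 4 * 3 - 1) * (x * x ^ l)"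
    by (simp add: algebra_simps)
qed

lemma gauss_rec_2_proj_points_le:
  fixes x :: real
  assumes "x \<ge> 2" "t \<le> n"
  shows "((x - 1) ^ 2 * (x ^ 2 - 1)) * (gauss_rec x 2 t * x ^ 2 * proj_points x (n - t)) \<le> x ^ (n + t + 5)"
proof -
  have x: "x > 1" using assms by simp
  have x2: "x ^ 2 > 1" using x by (intro one_less_power) auto
  have "((x - 1) ^ 2 * (x ^ 2 - 1)) * (gauss_rec x 2 t * x ^ 2 * proj_points x (n - t))
      = (x ^ (t + 1) - 1) * (x ^ (t + 2) - 1) * x ^ 2 * (x ^ (n - t) - 1)"
    unfolding gauss_rec_2[OF x] proj_points_def using x x2 by (simp add: power2_eq_square)
  also have "\<dots> \<le> x ^ (t + 1) * x ^ (t + 2) * x ^ 2 * x ^ (n - t)"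
    using x one_le_power[of x "t + 1"] one_le_power[of x "t + 2"] one_le_power[of x "n - t"]
    by (intro mult_mono) auto
  also have "\<dots> = x ^ (t + 1 + (t + 2) + 2 + (n - t))"
    by (simp only: power_add)
  also have "t + 1 + (t + 2) + 2 + (n - t) = n + t + 5"
    using assms by simp
  finally show ?thesis .
qed

section \<open>Bounds that fall below the size threshold\<close>

context
  fixes x :: real and n t l :: nat
  assumes t: "t \<ge> 1" and n: "t + 2 \<le> n"
    and x: "x = 2 \<and> n + t + 4 \<le> l \<or> x \<ge> 3 \<and> n + t + 2 \<le> l"
begin

private lemma x_ge_2: "x \<ge> 2" and l_ge_base: "n + t + 2 \<le> l"
  using x by auto

text \<open>After removal of the common factor, \<open>z\<close> has to stay below 47/48 of
  \<open>x ^ l\<close>, where \<open>z \<le> x ^ (n + t + 5) / c\<close>. For \<open>x = 2\<close>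
  the divisor \<open>c\<close> is only 3, so this estimate asks for
  \<open>n + t + 4 \<le> l\<close>; for \<open>x \<ge> 3\<close> it exceeds \<open>x ^ 3\<close> by
  enough.\<close>

lemma cover_bound_less_threshold: "cover_bound x l n t 2 < size_threshold x l (n - t - 1)"
proof -
  define c where "c = (x - 1) ^ 2 * (x ^ 2 - 1)"
  define z where "z = gauss_rec x 2 t * x ^ 2 * proj_points x (n - t)"
  have cz: "c * z \<le> x ^ (n + t + 5)"
    using gauss_rec_2_proj_points_le[of x t n] x_ge_2 n by (simp add: c_def z_def)
  have "48 * z < 47 * x ^ l"
    using x
  proof
    assume h: "x = 2 \<and> n + t + 4 \<le> l"
    have "n + t + 5 = Suc (n + t + 4)" by simp
    then have "3 * z \<le> 2 * 2 ^ (n + t + 4)" using cz h by (simp only: c_def power_Suc) simp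
    moreover have "(2::real) ^ (n + t + 4) \<le> 2 ^ l" using h by (intro power_increasing) auto
    moreover have "(2::real) ^ l > 0" by simp
    ultimately have "48 * z < 47 * 2 ^ l" by linarith
    then show ?thesis using h by simp
  next
    assume h: "x \<ge> 3 \<and> n + t + 2 \<le> l"
    have "n + t + 5 = 3 + (n + t + 2)" by simp
    then have "x ^ (n + t + 5) = x ^ 3 * x ^ (n + t + 2)" by (simp only: power_add[of x 3])
    also have "\<dots> \<le> x ^ 3 * x ^ l" using h by (intro mult_left_mono power_increasing) auto
    finally have 1: "c * z \<le> x ^ 3 * x ^ l" using cz by simp
    \<comment> \<open>This bound and the next are equalities at \<open>x = 3\<close>. Their product
      gives \<open>c \<ge> 32 / 81 * x ^ 4 \<ge> 96 / 81 * x ^ 3\<close>, and 96/81 exceeds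
      48/47.\<close>
    have a: "9 * (x - 1) ^ 2 \<ge> 4 * x ^ 2"
    proof -
      have "(2 * x) ^ 2 \<le> (3 * (x - 1)) ^ 2" using h by (intro power_mono) auto
      then show ?thesis unfolding power_mult_distrib by simp
    qed
    have b: "9 * (x ^ 2 - 1) \<ge> 8 * x ^ 2"
    proof -
      have "3 ^ 2 \<le> x ^ 2" using h by (intro power_mono) auto
      then show ?thesis by simp
    qed
    have "(4 * x ^ 2) * (8 * x ^ 2) \<le> (9 * (x - 1) ^ 2) * (9 * (x ^ 2 - 1))"
      by (rule mult_mono[OF a b]) auto
    moreover have "(4 * x ^ 2) * (8 * x ^ 2) = 32 * x ^ 4" by (simp flip: power_add)
    moreover have "(9 * (x - 1) ^ 2) * (9 * (x ^ 2 - 1)) = 81 * c" by (simp add: c_def)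
    ultimately have "32 * x ^ 4 \<le> 81 * c" by linarith
    moreover have "3 * x ^ 3 \<le> x ^ 4" using h by (simp add: power3_eq_cube power4_eq_xxxx)
    ultimately have "96 * x ^ 3 \<le> 81 * c" by linarith
    moreover have x3: "x ^ 3 > 0" using h by simp
    ultimately have c: "48 * x ^ 3 < 47 * c" "c > 0" by linarith+
    have "48 * (c * z) \<le> (48 * x ^ 3) * x ^ l" using 1 by simp
    also have "\<dots> < (47 * c) * x ^ l" using c h by (intro mult_strict_right_mono) auto
    finally have "c * (48 * z) < c * (47 * x ^ l)" by (simp add: mult_ac)
    then show ?thesis using c by simp
  qed
  then have "48 * (x * z) < 47 * (x * x ^ l)"
    using x_ge_2 mult_strict_left_mono[of "48 * z" "47 * x ^ l" x] by (simp add: mult_ac)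
  then have "x ^ (l * (n - t - 2)) * proj_points x (n - t - 1) * (x * z) < size_threshold x l (n - t - 1)"
    by (rule less_size_threshold'[OF x_ge_2 t n l_ge_base])
  moreover have "cover_bound x l n t 2 = x ^ (l * (n - t - 2)) * proj_points x (n - t - 1) * (x * z)"
    unfolding cover_bound_def z_def by (simp add: numeral_2_eq_2)
  ultimately show ?thesis by simp
qed

text \<open>The summands bound the members with and without a covering
  \<open>(t + 1)\<close>-subspace when \<open>dim D < n\<close>. Without the common factor they
  become \<open>x ^ l\<close>, at most half of \<open>x ^ (l + 1)\<close>, and
  \<open>z \<le> x ^ (n + 4) / (x - 1) ^ 2\<close>.\<close>

lemma few_covers_less_threshold:
  "proj_points x (n - t - 1) * x ^ (l * (n - t - 1))
    + proj_points x (t + 1) * (x * proj_points x (n - t) * (x ^ 2 * proj_points x (n - t - 1) * x ^ (l * (n - t - 2))))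
    < size_threshold x l (n - t - 1)"
proof -
  define z where "z = x ^ 3 * proj_points x (t + 1) * proj_points x (n - t)"
  have "z * (x - 1) ^ 2 = x ^ 3 * ((x ^ (t + 1) - 1) * (x ^ (n - t) - 1))"
    unfolding z_def proj_points_def using x_ge_2 by (simp add: power2_eq_square)
  also have "\<dots> \<le> x ^ 3 * (x ^ (t + 1) * x ^ (n - t))"
    using x_ge_2 one_le_power[of x "t + 1"] one_le_power[of x "n - t"]
    by (intro mult_left_mono mult_mono) auto
  also have "\<dots> = x ^ (3 + (t + 1 + (n - t)))" by (simp only: power_add)
  also have "3 + (t + 1 + (n - t)) = n + 4" using n by simp
  finally have z: "z * (x - 1) ^ 2 \<le> x ^ (n + 4)" .
  have "48 * (x ^ l + z) < 47 * (x * x ^ l)"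
    using x
  proof
    assume h: "x = 2 \<and> n + t + 4 \<le> l"
    have "2 * (2::real) ^ (n + 4) = 2 ^ (n + 5)" by (simp flip: power_Suc)
    also have "\<dots> \<le> (2::real) ^ l" using h t by (intro power_increasing) auto
    finally have "2 * z \<le> x ^ l" using z h by simp
    moreover have "x ^ l > 0" "2 * x ^ l \<le> x * x ^ l" using h by auto
    ultimately show ?thesis unfolding distrib_left by linarith
  next
    assume h: "x \<ge> 3 \<and> n + t + 2 \<le> l"
    have "x ^ (n + 4) \<le> x ^ Suc l" using h t by (intro power_increasing) auto
    then have z': "z * (x - 1) ^ 2 \<le> x * x ^ l" using z by simp
    have nn: "z \<ge> 0" unfolding z_def using x_ge_2 by (intro mult_nonneg_nonneg proj_points_nonneg) auto
    have "(x - 1) ^ 2 \<ge> 2 ^ 2" using h by (intro power_mono) auto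
    then have "z * 4 \<le> z * (x - 1) ^ 2" using nn by (intro mult_left_mono) auto
    then have "4 * z \<le> x * x ^ l" using z' by simp
    moreover have "3 * x ^ l \<le> x * x ^ l" using h by (intro mult_right_mono) auto
    moreover have "x ^ l > 0" using h by simp
    ultimately show ?thesis unfolding distrib_left by linarith
  qed
  then have "x ^ (l * (n - t - 2)) * proj_points x (n - t - 1) * (x ^ l + z) < size_threshold x l (n - t - 1)"
    by (rule less_size_threshold'[OF x_ge_2 t n l_ge_base])
  moreover have "x ^ (l * (n - t - 1)) = x ^ l * x ^ (l * (n - t - 2))"
  proof -
    have "n - t - 1 = Suc (n - t - 2)" using n by simp
    then show ?thesis by (simp add: power_add)
  qed
  ultimately show ?thesis by (simp add: z_def algebra_simps power2_eq_square power3_eq_cube)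
qed

text \<open>The assumption says \<open>t + 2 \<le> n - t - 1\<close>, which lets the common factor
  replace \<open>proj_points x (t + 2)\<close>. This forces \<open>n \<le> 2 * t + 2\<close> for
  large families of type \<open>(t + 2, 0)\<close>.\<close>

lemma H3_type_0_less_threshold:
  assumes "2 * t + 3 \<le> n"
  shows "proj_points x (t + 2) * x ^ (l * (n - t - 1)) < size_threshold x l (n - t - 1)"
proof -
  have "n - t - 1 = Suc (n - t - 2)" using n by simp
  then have e: "x ^ (l * (n - t - 1)) = x ^ (l * (n - t - 2)) * x ^ l" by (simp add: power_add)
  have "x ^ (t + 2) \<le> x ^ (n - t - 1)"
    using assms x_ge_2 by (intro power_increasing) auto
  then have "proj_points x (t + 2) \<le> proj_points x (n - t - 1)"
    unfolding proj_points_def using x_ge_2 by (intro divide_right_mono) auto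
  then have "proj_points x (t + 2) * x ^ (l * (n - t - 1))
      \<le> proj_points x (n - t - 1) * x ^ (l * (n - t - 1))"
    using x_ge_2 by (intro mult_right_mono) auto
  also have "\<dots> = x ^ (l * (n - t - 2)) * proj_points x (n - t - 1) * x ^ l"
    unfolding e by (simp only: mult_ac)
  also have "\<dots> < size_threshold x l (n - t - 1)"
  proof (rule less_size_threshold'[OF x_ge_2 t n l_ge_base])
    have "2 * x ^ l \<le> x * x ^ l" "x ^ l > 0" using x_ge_2 by (auto intro: mult_right_mono)
    then show "48 * x ^ l < 47 * (x * x ^ l)" by linarith
  qed
  finally show ?thesis .
qed

text \<open>Here the bound is the fraction \<open>x / (x + 1)\<close> of the main term, which tends
  to 1 as \<open>x\<close> grows. The fixed constant 47/48 is then too weak, so the sharper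
  \<open>less_size_threshold\<close> is used.\<close>

lemma H3_type_1_less_threshold:
  assumes "2 * t + 2 \<le> n"
  shows "x ^ (t + 1) * x ^ (l * (n - t - 1)) < size_threshold x l (n - t - 1)"
proof -
  define a where "a = n - t - 3"
  have a: "n - t - 1 = a + 2" "n - t - 2 = a + 1" using assms t by (auto simp: a_def)
  have e: "x ^ (l * (n - t - 1)) = x ^ (l * (n - t - 2)) * x ^ l"
    unfolding a by (simp add: power_add algebra_simps)
  have ta: "x ^ (t + 1) \<le> x ^ (a + 2)"
    using assms x_ge_2 by (intro power_increasing) (auto simp: a_def)
  \<comment> \<open>The two leading terms of the geometric sum for
    \<open>proj_points x (a + 2)\<close>.\<close>
  have pp: "x ^ a * (x + 1) \<le> proj_points x (n - t - 1)"
  proof -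
    have "x ^ a \<ge> 1" using x_ge_2 by (intro one_le_power) auto
    then have "x ^ a * (x + 1) * (x - 1) \<le> x ^ (a + 2) - 1"
      by (simp add: algebra_simps power2_eq_square)
    then show ?thesis unfolding proj_points_def a using x_ge_2 by (simp add: pos_le_divide_eq)
  qed
  define y where "y = x ^ 2 * x ^ l / (x + 1)"
  have y: "x ^ 2 * x ^ l = (x + 1) * y" using x_ge_2 by (simp add: y_def)
  have y0: "y \<ge> 0" using x_ge_2 by (simp add: y_def)
  have "x ^ (t + 1) * x ^ (l * (n - t - 1)) \<le> x ^ (a + 2) * x ^ (l * (n - t - 1))"
    using ta x_ge_2 by (intro mult_right_mono) auto
  also have "\<dots> = x ^ (l * (n - t - 2)) * (x ^ a * (x ^ 2 * x ^ l))"
    unfolding e power_add by (simp only: mult_ac)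
  also have "\<dots> = x ^ (l * (n - t - 2)) * (x ^ a * (x + 1)) * y"
    unfolding y by (simp only: mult_ac)
  also have "\<dots> \<le> x ^ (l * (n - t - 2)) * proj_points x (n - t - 1) * y"
    using pp y0 x_ge_2 by (intro mult_right_mono mult_left_mono) auto
  also have "\<dots> < size_threshold x l (n - t - 1)"
  proof (rule less_size_threshold[OF x_ge_2 t n l_ge_base])
    have "x * 1 \<le> x * x ^ 3" using x_ge_2 one_le_power[of x 3] by (intro mult_left_mono) auto
    then have "x \<le> x ^ 4" by (simp add: power3_eq_cube power4_eq_xxxx)
    then have "x ^ 4 * 3 - x - 1 > 0" using x_ge_2 by linarith
    then have "0 < (x ^ 4 * 3 - x - 1) * (x * x ^ l)" using x_ge_2 by simp
    then have "x ^ 4 * 3 * (x ^ 2 * x ^ l) < (x + 1) * ((x ^ 4 * 3 - 1) * (x * x ^ l))"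
      by (simp add: algebra_simps power2_eq_square)
    then have "(x + 1) * (x ^ 4 * 3 * y) < (x + 1) * ((x ^ 4 * 3 - 1) * (x * x ^ l))"
      unfolding y by (simp only: mult_ac)
    then show "x ^ 4 * 3 * y < (x ^ 4 * 3 - 1) * (x * x ^ l)" using x_ge_2 by simp
  qed
  finally show ?thesis .
qed

end

lemma size_threshold_conv_gauss_binom:
  assumes "q \<ge> 2" "t + 2 \<le> n"
  shows "real q ^ (l * (n - t - 1) + 1) * theta q (int n - int t - 1)
         - real q ^ (l * (n - t - 2) + 3) * gauss_binom q (int n - int t - 1) 2
       = size_threshold (real q) l (n - t - 1)"
proof -
  define a where "a = n - t - 2"
  have a: "n - t - 1 = Suc a" "n - t - 2 = a" "int n - int t - 1 = int (Suc a)"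
    using assms by (auto simp: a_def)
  have s: "{..<nat 2} = {0, 1}" by auto
  have "theta q (int (Suc a)) = proj_points (real q) (Suc a)"
    unfolding theta_def gauss_binom_def proj_points_def by (simp del: of_nat_Suc add: lessThan_Suc)
  moreover have "gauss_binom q (int (Suc a)) 2
      = proj_points (real q) (Suc a) * (real q ^ a - 1) / (real q ^ 2 - 1)"
  proof -
    have "int (Suc a) - int 1 = int a" by simp
    then have "gauss_binom q (int (Suc a)) 2
        = (real q powi (int (Suc a)) - 1) / (real q powi 2 - 1) * ((real q powi (int a) - 1) / (real q powi 1 - 1))"
      unfolding gauss_binom_def s by simp
    then show ?thesis unfolding proj_points_def power_int_of_nat by simp
  qed
  ultimately show ?thesis
    unfolding size_threshold_def a by simp
qed

section \<open>Subspaces over a finite field\<close>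

locale finite_field_space = finite_dimensional_vector_space scale Basis
  for scale :: "'a::{field,finite} \<Rightarrow> 'b::ab_group_add \<Rightarrow> 'b" and Basis +
  fixes q :: nat
  assumes card_scalars: "q = CARD('a)"
begin

abbreviation Q :: real where "Q \<equiv> real q"

lemma q_ge_2: "q \<ge> 2"
proof -
  have "card {0, 1::'a} \<le> CARD('a)"
    by (rule card_mono) auto
  then show ?thesis
    using card_scalars by auto
qed

lemma Q_gt_1: "Q > 1"
  using q_ge_2 by simp

lemma dim_span_Un_Int:
  assumes "subspace A" "subspace B"
  shows "dim (span (A \<union> B)) + dim (A \<inter> B) = dim A + dim B"
proof -
  have "span (A \<union> B) = {x + y | x y. x \<in> A \<and> y \<in> B}"
    unfolding span_Un using assms by (simp add: span_eq_iff[THEN iffD2])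
  then show ?thesis
    using dim_sums_Int[OF assms] by metis
qed

lemma dim_span_Un_direct:
  assumes "subspace A" "subspace B" "A \<inter> B \<subseteq> {0}"
  shows "dim (span (A \<union> B)) = dim A + dim B"
proof -
  have "dim (A \<inter> B) = 0" using assms(3) dim_eq_0 by blast
  then show ?thesis using dim_span_Un_Int[OF assms(1,2)] by linarith
qed

lemma span_Un_subset:
  assumes "subspace C" "A \<subseteq> C" "B \<subseteq> C"
  shows "span (A \<union> B) \<subseteq> C"
  using assms by (simp add: span_minimal)

lemma dim_Int_ge:
  assumes "subspace A" "subspace B" "subspace U" "A \<subseteq> U" "B \<subseteq> U"
  shows "dim A + dim B \<le> dim (A \<inter> B) + dim U"
  using dim_span_Un_Int[OF assms(1,2)] dim_subset[OF span_Un_subset[OF assms(3-5)]] by linarith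

lemma span_insert_subset:
  assumes "subspace C" "A \<subseteq> C" "v \<in> C"
  shows "span (insert v A) \<subseteq> C"
  using assms by (simp add: span_minimal)

lemma dim_span_insert:
  assumes "subspace S" "v \<notin> S"
  shows "dim (span (insert v S)) = Suc (dim S)"
proof -
  have "v \<notin> span S" using assms by (metis span_eq_iff)
  then show ?thesis by (simp add: dim_insert)
qed

lemma subspace_between:
  assumes "subspace X" "subspace D" "X \<subseteq> D" "dim X \<le> k" "k \<le> dim D"
  obtains M where "subspace M" "X \<subseteq> M" "M \<subseteq> D" "dim M = k"
proof -
  have "\<exists>M. subspace M \<and> X \<subseteq> M \<and> M \<subseteq> D \<and> dim M = k"
    using assms(4,5)
  proof (induction k rule: dec_induct)
    case base
    then show ?case using assms by blast
  next
    case (step k)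
    then obtain M where M: "subspace M" "X \<subseteq> M" "M \<subseteq> D" "dim M = k"
      by auto
    then obtain v where v: "v \<in> D" "v \<notin> M"
      using step.prems dim_subset[of D M] by fastforce
    have "span (insert v M) \<subseteq> D"
      by (rule span_insert_subset) (use M v assms in auto)
    moreover have "M \<subseteq> span (insert v M)"
      using span_superset by blast
    ultimately show ?case
      using dim_span_insert[of M v] M v by (intro exI[of _ "span (insert v M)"]) auto
  qed
  then show ?thesis using that by blast
qed

section \<open>Cardinalities and double counting\<close>

lemma card_span_independent:
  assumes "finite B" "independent B"
  shows "finite (span B) \<and> card (span B) = q ^ card B"
  using assms
proof (induction B rule: finite_induct)
  case empty
  then show ?case by simp
next
  case (insert b B)
  have b: "b \<notin> span B"
    using insert by (metis dependent_def insertI1 Diff_insert_absorb)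
  have ind: "finite (span B)" "card (span B) = q ^ card B"
    using insert dependent_mono[of B "insert b B"] by auto
  let ?f = "\<lambda>(k, x). scale k b + x"
  have img: "span (insert b B) = ?f ` (UNIV \<times> span B)"
  proof (rule set_eqI, rule iffI)
    fix x assume "x \<in> span (insert b B)"
    then obtain k where "x - scale k b \<in> span B"
      using span_breakdown_eq by blast
    then show "x \<in> ?f ` (UNIV \<times> span B)"
      by (intro image_eqI[of _ _ "(k, x - scale k b)"]) auto
  next
    fix x assume "x \<in> ?f ` (UNIV \<times> span B)"
    then obtain k y where "y \<in> span B" "x = scale k b + y" by auto
    then show "x \<in> span (insert b B)"
      unfolding span_breakdown_eq by (intro exI[of _ k]) simp
  qed
  have inj: "inj_on ?f (UNIV \<times> span B)"
  proof (rule inj_onI, clarsimp)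
    fix k x k' x' assume x: "x \<in> span B" "x' \<in> span B" and e: "scale k b + x = scale k' b + x'"
    have d: "scale (k - k') b = x' - x"
      using e by (simp add: scale_left_diff_distrib algebra_simps)
    have "k = k'"
    proof (rule ccontr)
      assume "k \<noteq> k'"
      then have "b = scale (inverse (k - k')) (x' - x)"
        using d[symmetric] by simp
      then show False
        using b x span_diff span_scale by metis
    qed
    then show "k = k' \<and> x = x'" using e by simp
  qed
  show ?case
    unfolding img using card_image[OF inj] ind insert by (simp add: card_cartesian_product card_scalars)
qed

lemma finite_UNIV_space: "finite (UNIV :: 'b set)"
  using card_span_independent[OF finite_Basis independent_Basis] unfolding span_Basis by blast

lemma finite_vectors [simp, intro]: "finite (A :: 'b set)"
  by (rule finite_subset[OF subset_UNIV finite_UNIV_space])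

lemma finite_families [simp, intro]: "finite (G :: 'b set set)"
  by (rule finite_subset[OF subset_UNIV Finite_Set.finite_set[THEN iffD2, OF finite_UNIV_space]])

lemma card_subspace:
  assumes "subspace S"
  shows "real (card S) = Q ^ dim S"
proof -
  obtain B where B: "finite B" "independent B" "span B = S" "card B = dim S"
    by (rule basis_subspace_exists[OF assms])
  have "card (span B) = q ^ card B"
    using card_span_independent[OF B(1,2)] by blast
  then show ?thesis
    unfolding B(3,4) by simp
qed

text \<open>Counts pairs of a member \<open>F\<close> and a vector \<open>v \<in> F\<close> with
  \<open>v \<in> U - U0\<close>. Each \<open>F\<close> has at least \<open>Q ^ a\<close> vectors in
  \<open>U\<close>, of which those in \<open>U0\<close> lie in \<open>S\<close>; each
  \<open>v\<close> occurs at most \<open>K\<close> times. All later counts of extensions go through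
  this inequality.\<close>

lemma double_count:
  assumes S: "subspace S" and U: "subspace U" "subspace U0" "S \<subseteq> U0" "U0 \<subseteq> U"
    and G: "\<And>F. F \<in> G \<Longrightarrow> subspace F \<and> S \<subseteq> F \<and> a \<le> dim (F \<inter> U) \<and> F \<inter> U0 \<subseteq> S"
    and K: "\<And>v. v \<in> U - U0 \<Longrightarrow> real (card {F \<in> G. v \<in> F}) \<le> K"
  shows "real (card G) * (Q ^ a - Q ^ dim S) \<le> (Q ^ dim U - Q ^ dim U0) * K"
proof -
  have "real (card G) * (Q ^ a - Q ^ dim S) = (\<Sum>F\<in>G. Q ^ a - Q ^ dim S)"
    by simp
  also have "\<dots> \<le> (\<Sum>F\<in>G. real (card {v \<in> U - U0. v \<in> F}))"
  proof (rule sum_mono)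
    fix F assume "F \<in> G"
    note F = G[OF this]
    have "Q ^ a \<le> Q ^ dim (F \<inter> U)"
      using F Q_gt_1 by (intro power_increasing) auto
    also have "\<dots> = real (card (F \<inter> U))"
      using card_subspace[OF subspace_inter[of F U]] F U(1) by simp
    also have "\<dots> \<le> real (card ({v \<in> U - U0. v \<in> F} \<union> S))"
      using F by (intro of_nat_mono card_mono) auto
    also have "\<dots> \<le> real (card {v \<in> U - U0. v \<in> F}) + real (card S)"
      using of_nat_mono[OF card_Un_le, where 'a = real] by simp
    finally show "Q ^ a - Q ^ dim S \<le> real (card {v \<in> U - U0. v \<in> F})"
      using card_subspace[OF S] by simp
  qed
  also have "\<dots> = (\<Sum>v\<in>U - U0. real (card {F \<in> G. v \<in> F}))"
  proof -
    have "(\<Sum>F\<in>G. card {v \<in> U - U0. v \<in> F}) = (\<Sum>v\<in>U - U0. card {F \<in> G. v \<in> F})"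
      using sum_multicount_gen[of G "U - U0" "\<lambda>F v. v \<in> F" "\<lambda>v. card {F \<in> G. v \<in> F}"] by simp
    then show ?thesis
      unfolding of_nat_sum[symmetric] by (rule arg_cong)
  qed
  also have "\<dots> \<le> (\<Sum>v\<in>U - U0. K)"
    by (rule sum_mono) (rule K)
  also have "\<dots> = (real (card U) - real (card U0)) * K"
  proof -
    have "card U0 \<le> card U" "card (U - U0) = card U - card U0"
      using card_mono[OF finite_vectors U(4)] card_Diff_subset[OF finite_vectors U(4)] by auto
    then show ?thesis by (simp add: of_nat_diff)
  qed
  finally show ?thesis
    unfolding card_subspace[OF U(1)] card_subspace[OF U(2)] .
qed

text \<open>A vector on the left with nonzero coefficient at \<open>v\<close> would put
  \<open>v\<close> into \<open>S + Y\<close>.\<close>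

lemma span_insert_Int:
  assumes "subspace S" "subspace Y" "v \<notin> span (S \<union> Y)"
  shows "span (insert v S) \<inter> Y = S \<inter> Y"
proof
  show "span (insert v S) \<inter> Y \<subseteq> S \<inter> Y"
  proof
    fix x assume x: "x \<in> span (insert v S) \<inter> Y"
    then obtain k where "x - scale k v \<in> span S"
      using span_breakdown_eq[of x v S] by blast
    then have k: "x - scale k v \<in> S"
      using span_eq_iff[THEN iffD2, OF assms(1)] by simp
    have "k = 0"
    proof (rule ccontr)
      assume "k \<noteq> 0"
      have "x \<in> span (S \<union> Y)" "x - scale k v \<in> span (S \<union> Y)"
        using k x by (auto intro: span_base)
      then have "x - (x - scale k v) \<in> span (S \<union> Y)"
        by (rule span_diff)
      then have "scale k v \<in> span (S \<union> Y)"
        by simp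
      then show False
        using span_scale[of "scale k v" "S \<union> Y" "inverse k"] assms(3) \<open>k \<noteq> 0\<close> by simp
    qed
    then show "x \<in> S \<inter> Y" using k x by simp
  qed
  show "S \<inter> Y \<subseteq> span (insert v S) \<inter> Y"
    using span_superset[of "insert v S"] by blast
qed

text \<open>For \<open>v\<close> in \<open>Z\<close> outside \<open>S + Y\<close>, every complement
  \<open>H\<close> of \<open>Y\<close> in \<open>Z\<close> satisfies \<open>H + Y = Z\<close> and so
  contains \<open>v + w\<close> for some \<open>w \<in> Y\<close>. Enlarging \<open>S\<close> by
  \<open>v + w\<close> costs a factor \<open>Q ^ dim Y\<close> per dimension.\<close>

lemma card_complements:
  assumes Y: "subspace Y" and Z: "subspace Z" and "Y \<subseteq> Z" "dim Z = h + dim Y"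
    and S: "subspace S" "S \<subseteq> Z" "S \<inter> Y \<subseteq> {0}"
    and G: "\<And>H. H \<in> G \<Longrightarrow> subspace H \<and> H \<subseteq> Z \<and> S \<subseteq> H \<and> dim H = h \<and> H \<inter> Y \<subseteq> {0}"
  shows "real (card G) \<le> Q ^ (dim Y * (h - dim S))"
  using S G
proof (induction "h - dim S" arbitrary: S G)
  case 0
  \<comment> \<open>Truncated subtraction gives only \<open>h \<le> dim S\<close>; since the sum of
    \<open>S\<close> and \<open>Y\<close> is direct and fits into \<open>Z\<close>, equality
    follows.\<close>
  have "dim S + dim Y \<le> h + dim Y"
    using dim_span_Un_direct[of S Y] dim_subset[of "span (S \<union> Y)" Z] span_Un_subset[of Z S Y]
      assms(1-4) "0.prems" by auto
  then have "dim S = h" using 0(1) by simp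
  then have "H = S" if "H \<in> G" for H
    using "0.prems"(4)[OF that] subspace_dim_equal[of S H] "0.prems"(1) by auto
  then have "G \<subseteq> {S}" by auto
  then have "card G \<le> card {S}" by (rule card_mono[rotated]) simp
  then show ?case using 0(1)[symmetric] by simp
next
  case (Suc d)
  have "dim (span (S \<union> Y)) < dim Z"
    using dim_span_Un_direct[OF Suc.prems(1) Y Suc.prems(3)] assms(4) Suc(2) by linarith
  then obtain v where v: "v \<in> Z" "v \<notin> span (S \<union> Y)"
    using dim_subset[of Z "span (S \<union> Y)"] by (metis not_le subsetI)
  have cov: "G \<subseteq> (\<Union>w\<in>Y. {H \<in> G. v + w \<in> H})"
  proof
    fix H assume HG: "H \<in> G"
    note H = Suc.prems(4)[OF HG]
    have "dim (span (H \<union> Y)) = dim Z"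
      using dim_span_Un_direct[of H Y] H Y assms(4) by simp
    then have "span (H \<union> Y) = Z"
      using subspace_dim_equal[of "span (H \<union> Y)" Z] span_Un_subset[of Z H Y] H assms(2,3) by simp
    then have "v \<in> {x + y | x y. x \<in> H \<and> y \<in> Y}"
      using v(1) H Y unfolding span_Un by (simp add: span_eq_iff[THEN iffD2])
    then obtain x y where "x \<in> H" "y \<in> Y" "v = x + y"
      by blast
    then have "v + (- y) \<in> H" "- y \<in> Y"
      using subspace_neg Y by auto
    then show "H \<in> (\<Union>w\<in>Y. {H \<in> G. v + w \<in> H})"
      using HG by blast
  qed
  have each: "real (card {H \<in> G. v + w \<in> H}) \<le> Q ^ (dim Y * d)" if w: "w \<in> Y" for w
  proof -
    have nin: "v + w \<notin> span (S \<union> Y)"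
      using v w span_add_eq2[of w "S \<union> Y" v] span_base[of w "S \<union> Y"] by blast
    let ?S = "span (insert (v + w) S)"
    have dS: "dim ?S = Suc (dim S)"
      using dim_span_insert[OF Suc.prems(1), of "v + w"] nin span_base[of "v + w" "S \<union> Y"] by blast
    have "?S \<subseteq> Z"
      using Suc.prems(2) w v \<open>Y \<subseteq> Z\<close> Z by (intro span_insert_subset) (auto intro: subspace_add)
    moreover have "?S \<inter> Y \<subseteq> {0}"
      using span_insert_Int[of S Y "v + w"] nin Suc.prems(1,3) Y by simp
    moreover have "subspace H \<and> H \<subseteq> Z \<and> ?S \<subseteq> H \<and> dim H = h \<and> H \<inter> Y \<subseteq> {0}"
      if "H \<in> {H \<in> G. v + w \<in> H}" for H
      using Suc.prems(4)[of H] that span_insert_subset[of H S "v + w"] by auto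
    moreover have "d = h - dim ?S" using dS Suc(2) by simp
    ultimately show ?thesis
      using Suc.hyps(1)[of ?S "{H \<in> G. v + w \<in> H}"] by simp
  qed
  have "card G \<le> card (\<Union>w\<in>Y. {H \<in> G. v + w \<in> H})"
    by (rule card_mono[OF _ cov]) simp
  also have "\<dots> \<le> (\<Sum>w\<in>Y. card {H \<in> G. v + w \<in> H})"
    by (rule card_UN_le) simp
  finally have "real (card G) \<le> (\<Sum>w\<in>Y. real (card {H \<in> G. v + w \<in> H}))"
    unfolding of_nat_sum[symmetric] by (rule of_nat_mono)
  also have "\<dots> \<le> (\<Sum>w\<in>Y. Q ^ (dim Y * d))"
    by (rule sum_mono) (rule each)
  also have "\<dots> = Q ^ (dim Y * Suc d)"
    using card_subspace[OF Y] by (simp add: power_add)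
  finally show ?case unfolding Suc(2) .
qed

text \<open>Each \<open>T\<close> is spanned by \<open>X\<close> and any vector of
  \<open>T - X\<close>, so double counting applies with \<open>K = 1\<close>. The bound is the
  number of points of the quotient of \<open>D\<close> by \<open>X\<close>.\<close>

lemma card_between_le:
  assumes "subspace X" "subspace D" "X \<subseteq> D"
    and \<T>: "\<And>T. T \<in> \<T> \<Longrightarrow> subspace T \<and> X \<subseteq> T \<and> T \<subseteq> D \<and> dim T = dim X + 1"
  shows "real (card \<T>) \<le> proj_points Q (dim D - dim X)"
proof -
  have "real (card \<T>) * (Q ^ (dim X + 1) - Q ^ dim X) \<le> (Q ^ dim D - Q ^ dim X) * 1"
  proof (rule double_count[OF assms(1,2,1) subset_refl assms(3)])
    fix T assume T: "T \<in> \<T>"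
    then have "T \<inter> D = T" using \<T> by blast
    then show "subspace T \<and> X \<subseteq> T \<and> dim X + 1 \<le> dim (T \<inter> D) \<and> T \<inter> X \<subseteq> X"
      using \<T>[OF T] by simp
  next
    fix v assume v: "v \<in> D - X"
    have "{T \<in> \<T>. v \<in> T} \<subseteq> {span (insert v X)}"
    proof clarify
      fix T assume T: "T \<in> \<T>" "v \<in> T"
      have "span (insert v X) = T"
        using \<T>[OF T(1)] T(2) dim_span_insert[OF assms(1), of v] v span_insert_subset[of T X v]
        by (intro subspace_dim_equal) auto
      then show "T = span (insert v X)" ..
    qed
    then have "card {T \<in> \<T>. v \<in> T} \<le> card {span (insert v X)}"
      by (rule card_mono[rotated]) simp
    then show "real (card {T \<in> \<T>. v \<in> T}) \<le> 1" by simp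
  qed
  moreover have "Q ^ dim D = Q ^ dim X * Q ^ (dim D - dim X)"
    using dim_subset[OF assms(3)] by (simp flip: power_add)
  ultimately have "Q ^ dim X * (real (card \<T>) * (Q - 1)) \<le> Q ^ dim X * (Q ^ (dim D - dim X) - 1)"
    by (simp add: algebra_simps)
  then have "real (card \<T>) * (Q - 1) \<le> Q ^ (dim D - dim X) - 1"
    using Q_gt_1 by simp
  then show ?thesis unfolding proj_points_def using Q_gt_1 by (simp add: field_simps)
qed

end

section \<open>Complements of a fixed subspace\<close>

locale attenuated_space = finite_field_space scale Basis q
  for scale :: "'a::{field,finite} \<Rightarrow> 'b::ab_group_add \<Rightarrow> 'b" and Basis q +
  fixes W :: "'b set" and n l :: nat
  assumes subspace_W: "subspace W"
    and dim_W: "dim W = l"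
    and dim_V: "dim UNIV = n + l"
begin

definition transversal :: "'b set \<Rightarrow> bool" where
  "transversal H \<longleftrightarrow> subspace H \<and> H \<inter> W \<subseteq> {0}"

abbreviation complements :: "'b set set" where
  "complements \<equiv> typed_subspaces scale W UNIV n 0"

lemma has_type_0_iff: "has_type scale W m 0 H \<longleftrightarrow> transversal H \<and> dim H = m"
  unfolding has_type_def transversal_def using dim_eq_0[of "H \<inter> W"] by blast

lemma mem_complements: "F \<in> complements \<longleftrightarrow> transversal F \<and> dim F = n"
  unfolding typed_subspaces_def by (simp add: has_type_0_iff)

lemma transversal_subspace: "transversal H \<Longrightarrow> subspace H"
  unfolding transversal_def by blast

lemma complement_subspace: "F \<in> complements \<Longrightarrow> subspace F"
  by (simp add: mem_complements transversal_def)

lemma transversal_subset: "transversal H \<Longrightarrow> subspace S \<Longrightarrow> S \<subseteq> H \<Longrightarrow> transversal S"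
  unfolding transversal_def by blast

text \<open>\<open>F\<close> and \<open>W\<close> already span the whole space, hence so do
  \<open>U\<close> and \<open>W\<close>.\<close>

lemma dim_above_complement:
  assumes F: "F \<in> complements" and U: "subspace U" "F \<subseteq> U"
  shows "dim U = n + dim (U \<inter> W)"
proof -
  have "dim (span (F \<union> W)) = n + l"
    using F dim_span_Un_direct[of F W] subspace_W dim_W
    by (simp add: mem_complements transversal_def)
  moreover have "dim (span (F \<union> W)) \<le> dim (span (U \<union> W))"
    using U by (intro dim_subset span_mono) blast
  moreover have "dim (span (U \<union> W)) \<le> n + l"
    using dim_subset[OF subset_UNIV, of "span (U \<union> W)"] unfolding dim_V .
  ultimately show ?thesis
    using dim_span_Un_Int[OF U(1) subspace_W] dim_W by linarith
qed

lemma card_complements_above: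
  assumes S: "transversal S" and G: "G \<subseteq> complements" "\<And>F. F \<in> G \<Longrightarrow> S \<subseteq> F"
  shows "real (card G) \<le> Q ^ (l * (n - dim S))"
  using card_complements[OF subspace_W subspace_UNIV subset_UNIV, of n S G] S G dim_W dim_V
  unfolding mem_complements transversal_def subset_iff by (simp add: dim_V del: dim_UNIV)

text \<open>Each \<open>F \<in> G\<close> meets \<open>U = S + F'\<close> in at least \<open>q ^ (s + r)\<close> vectors, where \<open>r = t - dim (S \<inter> F')\<close>,
  and only vectors of \<open>U\<close> outside \<open>S + (U \<inter> W)\<close> can extend \<open>S\<close> inside such an \<open>F\<close>. Counting incident
  pairs instead of extensions makes the estimate uniform in \<open>r\<close>.\<close>

lemma card_noncover_le:
  assumes S: "transversal S" "t \<le> dim S" and F': "F' \<in> complements" "dim (S \<inter> F') < t"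
    and G: "G \<subseteq> complements" "\<And>F. F \<in> G \<Longrightarrow> S \<subseteq> F \<and> t \<le> dim (F \<inter> F')"
    and K: "\<And>H. transversal H \<Longrightarrow> S \<subseteq> H \<Longrightarrow> dim H = dim S + 1 \<Longrightarrow> real (card {F \<in> G. H \<subseteq> F}) \<le> K"
  shows "real (card G) \<le> Q ^ (dim S - t + 1) * proj_points Q (n - dim S) * K"
proof -
  define U where "U = span (S \<union> F')"
  define U0 where "U0 = span (S \<union> (U \<inter> W))"
  define s where "s = dim S"
  define r where "r = t - dim (S \<inter> F')"
  have sub: "subspace S" "subspace F'" "subspace U" "subspace U0" "subspace (U \<inter> W)"
    using S F' subspace_W
    by (auto simp: U_def U0_def transversal_def mem_complements intro!: subspace_inter)
  have SU: "S \<subseteq> U" "F' \<subseteq> U" "S \<subseteq> U0" "U \<inter> W \<subseteq> U0"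
    unfolding U0_def using span_superset[of "S \<union> F'"] span_superset[of "S \<union> (U \<inter> W)"]
    unfolding U_def[symmetric] by blast+
  have U0U: "U0 \<subseteq> U"
    unfolding U0_def using sub SU by (intro span_Un_subset) auto
  \<comment> \<open>\<open>t - r\<close> is \<open>dim (S \<inter> F')\<close>. Comparison with
    \<open>dim U = n + dim (U \<inter> W)\<close> gives \<open>U \<inter> W\<close> the dimension
    \<open>s - t + r\<close>.\<close>
  have dU: "dim U + (t - r) = s + n"
    using dim_span_Un_Int[OF sub(1,2)] F' by (simp add: U_def r_def s_def mem_complements)
  have "dim U = n + dim (U \<inter> W)"
    by (rule dim_above_complement[OF F'(1) sub(3) SU(2)])
  moreover have "dim U0 = s + dim (U \<inter> W)"
    unfolding U0_def s_def using dim_span_Un_direct[OF sub(1,5)] S by (auto simp: transversal_def)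
  ultimately have dims: "dim U = n + (s - t + r)" "dim U0 = s + (s - t + r)"
    using dU S(2) F'(2) by (auto simp: s_def r_def)
  have count: "real (card G) * (Q ^ (s + r) - Q ^ dim S) \<le> (Q ^ dim U - Q ^ dim U0) * K"
  proof (rule double_count[OF sub(1,3,4) SU(3) U0U])
    fix F assume F: "F \<in> G"
    have FC: "F \<in> complements" using F G by blast
    have sF: "subspace F" using FC complement_subspace by blast
    \<comment> \<open>Since \<open>S \<subseteq> F\<close>, this sum has dimension
      \<open>s + dim (F \<inter> F') - dim (S \<inter> F')\<close>, which is at least
      \<open>s + r\<close>.\<close>
    have "span (S \<union> (F \<inter> F')) \<subseteq> F \<inter> U"
      using G(2)[OF F] SU sF sub by (intro span_Un_subset subspace_inter) auto
    then have "dim (span (S \<union> (F \<inter> F'))) \<le> dim (F \<inter> U)"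
      by (rule dim_subset)
    moreover have "dim (span (S \<union> (F \<inter> F'))) + dim (S \<inter> (F \<inter> F')) = s + dim (F \<inter> F')"
      unfolding s_def using sub sF by (intro dim_span_Un_Int subspace_inter) auto
    moreover have "S \<inter> (F \<inter> F') = S \<inter> F'"
      using G(2)[OF F] by blast
    ultimately have 1: "s + r \<le> dim (F \<inter> U)"
      using G(2)[OF F, THEN conjunct2] F'(2) unfolding r_def by simp
    \<comment> \<open>The \<open>W\<close>-component of such a vector lies in
      \<open>F \<inter> W\<close> and is therefore 0.\<close>
    have "F \<inter> U0 \<subseteq> S"
    proof
      fix x assume x: "x \<in> F \<inter> U0"
      then have "x \<in> {a + b | a b. a \<in> S \<and> b \<in> U \<inter> W}"
        unfolding U0_def span_Un using sub(1,5) by (simp add: span_eq_iff[THEN iffD2])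
      then obtain a b where ab: "a \<in> S" "b \<in> W" "x = a + b" by blast
      have "x - a \<in> F"
        using x ab G(2)[OF F] by (intro subspace_diff[OF sF]) auto
      then have "b = 0" using ab FC by (auto simp: mem_complements transversal_def)
      then show "x \<in> S" using ab by simp
    qed
    then show "subspace F \<and> S \<subseteq> F \<and> s + r \<le> dim (F \<inter> U) \<and> F \<inter> U0 \<subseteq> S"
      using 1 sF G(2)[OF F] by blast
  next
    fix v assume v: "v \<in> U - U0"
    let ?H = "span (insert v S)"
    have "v \<notin> span (S \<union> (U \<inter> W))" using v by (simp add: U0_def)
    then have "?H \<inter> (U \<inter> W) = S \<inter> (U \<inter> W)"
      by (rule span_insert_Int[OF sub(1,5)])
    moreover have "?H \<subseteq> U"
      using v sub SU by (intro span_insert_subset) auto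
    ultimately have "transversal ?H"
      using S unfolding transversal_def by blast
    moreover have "dim ?H = dim S + 1"
      using dim_span_insert[OF sub(1), of v] v SU by auto
    moreover have "S \<subseteq> ?H" using span_superset[of "insert v S"] by blast
    moreover have "{F \<in> G. v \<in> F} = {F \<in> G. ?H \<subseteq> F}"
    proof -
      have "v \<in> F \<longleftrightarrow> ?H \<subseteq> F" if "F \<in> G" for F
      proof
        assume "v \<in> F"
        then show "?H \<subseteq> F"
          using G that complement_subspace by (intro span_insert_subset) auto
      qed (use span_superset[of "insert v S"] in blast)
      then show ?thesis by blast
    qed
    ultimately show "real (card {F \<in> G. v \<in> F}) \<le> K"
      using K[of ?H] by presburger
  qed
  have "Q ^ s * (real (card G) * (Q ^ r - 1)) \<le> Q ^ s * (Q ^ (s - t + r) * (Q ^ (n - s) - 1) * K)"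
    if "s \<le> n"
  proof -
    have "Q ^ n = Q ^ s * Q ^ (n - s)" using that by (simp flip: power_add)
    then have "(Q ^ dim U - Q ^ dim U0) * K = Q ^ s * (Q ^ (s - t + r) * (Q ^ (n - s) - 1) * K)"
      unfolding dims by (simp add: power_add algebra_simps)
    moreover have "real (card G) * (Q ^ (s + r) - Q ^ dim S) = Q ^ s * (real (card G) * (Q ^ r - 1))"
      unfolding s_def by (simp add: power_add algebra_simps)
    ultimately show ?thesis using count by (simp only:)
  qed
  moreover have "s \<le> n"
  proof -
    have "dim (span (S \<union> W)) \<le> n + l"
      using dim_subset[OF subset_UNIV, of "span (S \<union> W)"] unfolding dim_V .
    then show ?thesis
      using dim_span_Un_direct[of S W] S(1) subspace_W dim_W by (simp add: transversal_def s_def)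
  qed
  ultimately have main: "real (card G) * (Q ^ r - 1) \<le> Q ^ (s - t + r) * (Q ^ (n - s) - 1) * K"
    using Q_gt_1 by simp
  have r1: "r \<ge> 1" using F'(2) by (simp add: r_def)
  \<comment> \<open>The dependence on \<open>r\<close> disappears here: \<open>Q ^ (r - 1)\<close>
    splits off both from \<open>Q ^ r - 1\<close>, as a lower bound, and from
    \<open>Q ^ (s - t + r)\<close>, and cancels.\<close>
  have "Q ^ (r - 1) * (real (card G) * (Q - 1)) \<le> real (card G) * (Q ^ r - 1)"
  proof -
    have "Q ^ (r - 1) * Q = Q ^ r" using r1 by (cases r) auto
    moreover have "Q ^ (r - 1) \<ge> 1" using Q_gt_1 by (intro one_le_power) auto
    ultimately have "Q ^ (r - 1) * (Q - 1) \<le> Q ^ r - 1"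
      by (simp add: algebra_simps)
    then have "real (card G) * (Q ^ (r - 1) * (Q - 1)) \<le> real (card G) * (Q ^ r - 1)"
      by (rule mult_left_mono) simp
    then show ?thesis by (simp add: mult_ac)
  qed
  also have "\<dots> \<le> Q ^ (r - 1) * (Q ^ (s - t + 1) * ((Q ^ (n - s) - 1) * K))"
  proof -
    have "s - t + r = (r - 1) + (s - t + 1)" using r1 by simp
    then have "Q ^ (s - t + r) = Q ^ (r - 1) * Q ^ (s - t + 1)" by (metis power_add)
    then show ?thesis using main by (simp only: mult.assoc)
  qed
  finally have "real (card G) * (Q - 1) \<le> Q ^ (s - t + 1) * ((Q ^ (n - s) - 1) * K)"
    using Q_gt_1 by simp
  then have "real (card G) \<le> Q ^ (s - t + 1) * ((Q ^ (n - s) - 1) * K) / (Q - 1)"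
    using Q_gt_1 by (simp only: pos_le_divide_eq diff_gt_0_iff_gt)
  also have "\<dots> = Q ^ (dim S - t + 1) * proj_points Q (n - dim S) * K"
    unfolding proj_points_def s_def by simp
  finally show ?thesis .
qed

text \<open>\<open>S\<close> grows inside \<open>T\<close> one dimension at a time until it has
  dimension \<open>t\<close>. With \<open>Suc j\<close> dimensions missing, double counting with
  \<open>U = T\<close> and \<open>U0 = S\<close> gives exactly the quotient in the recursion of
  \<open>gauss_rec\<close>.\<close>

lemma card_below_cover_le:
  assumes T: "subspace T" "dim T = t + d"
    and G: "G \<subseteq> complements" "\<And>F. F \<in> G \<Longrightarrow> t \<le> dim (F \<inter> T)"
    and K: "\<And>S. transversal S \<Longrightarrow> S \<subseteq> T \<Longrightarrow> dim S = t \<Longrightarrow> real (card {F \<in> G. S \<subseteq> F}) \<le> K"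
    and "K \<ge> 0"
  shows "real (card G) \<le> gauss_rec Q d t * K"
proof -
  have gen: "real (card {F \<in> G. S \<subseteq> F}) \<le> gauss_rec Q d j * K"
    if "transversal S" "S \<subseteq> T" "dim S + j = t" for S j
    using that
  proof (induction j arbitrary: S)
    case 0
    then show ?case using K[of S] by simp
  next
    case (Suc j)
    have sS: "subspace S" using Suc.prems transversal_subspace by blast
    let ?G = "{F \<in> G. S \<subseteq> F}"
    have "real (card ?G) * (Q ^ t - Q ^ dim S) \<le> (Q ^ dim T - Q ^ dim S) * (gauss_rec Q d j * K)"
    proof (rule double_count[OF sS T(1) sS subset_refl Suc.prems(2)])
      fix F assume "F \<in> ?G"
      then show "subspace F \<and> S \<subseteq> F \<and> t \<le> dim (F \<inter> T) \<and> F \<inter> S \<subseteq> S"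
        using G complement_subspace by auto
    next
      fix v assume v: "v \<in> T - S"
      let ?H = "span (insert v S)"
      show "real (card {F \<in> ?G. v \<in> F}) \<le> gauss_rec Q d j * K"
      \<comment> \<open>\<open>?H\<close> is known to be transversal only if some member contains
        it; otherwise the count is 0 and nonnegativity of the bound suffices.\<close>
      proof (cases "{F \<in> ?G. v \<in> F} = {}")
        case True
        then show ?thesis
          using gauss_rec_nonneg[OF Q_gt_1] \<open>K \<ge> 0\<close> by (metis card.empty mult_nonneg_nonneg of_nat_0)
      next
        case False
        have eq: "{F \<in> ?G. v \<in> F} = {F \<in> G. ?H \<subseteq> F}"
        proof -
          have "S \<subseteq> F \<and> v \<in> F \<longleftrightarrow> ?H \<subseteq> F" if "F \<in> G" for F
          proof
            assume "S \<subseteq> F \<and> v \<in> F"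
            then show "?H \<subseteq> F"
              using G that complement_subspace by (intro span_insert_subset) auto
          qed (use span_superset[of "insert v S"] in blast)
          then show ?thesis by blast
        qed
        then obtain F where "F \<in> G" "?H \<subseteq> F" using False by blast
        then have "transversal ?H"
          using G transversal_subset[of F ?H] mem_complements by blast
        moreover have "?H \<subseteq> T"
          using v T Suc.prems by (intro span_insert_subset) auto
        moreover have "dim ?H + j = t"
          using dim_span_insert[OF sS, of v] v Suc.prems by auto
        ultimately show ?thesis
          unfolding eq using Suc.IH[of ?H] by blast
      qed
    qed
    moreover have "Q ^ t = Q ^ dim S * Q ^ Suc j" "Q ^ dim T = Q ^ dim S * Q ^ (d + Suc j)"
      unfolding T Suc.prems(3)[symmetric] by (simp_all flip: power_add add: ac_simps)
    ultimately have "Q ^ dim S * (real (card ?G) * (Q ^ Suc j - 1))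
        \<le> Q ^ dim S * ((Q ^ (d + Suc j) - 1) * (gauss_rec Q d j * K))"
      by (simp add: algebra_simps)
    then have "real (card ?G) * (Q ^ Suc j - 1) \<le> (Q ^ (d + Suc j) - 1) * (gauss_rec Q d j * K)"
      using Q_gt_1 by simp
    moreover have "Q ^ Suc j > 1" using Q_gt_1 by (intro one_less_power) auto
    ultimately show ?case by (simp add: field_simps)
  qed
  have "transversal {0}" by (simp add: transversal_def)
  moreover have "{0} \<subseteq> T" using subspace_0[OF T(1)] by simp
  moreover have "{F \<in> G. {0} \<subseteq> F} = G" using G complement_subspace subspace_0 by blast
  ultimately show ?thesis using gen[of "{0}" t] by simp
qed

text \<open>As long as \<open>dim P < n\<close>, both \<open>P + W\<close> and \<open>P + Y\<close>
  are proper subspaces, and two proper subspaces do not cover the space. Adjoining a vector outside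
  both preserves transversality and the intersection with \<open>Y\<close>.\<close>

lemma extend_avoiding:
  assumes T: "transversal T" and Y: "subspace Y" and "dim Y \<le> l"
  obtains F where "F \<in> complements" "T \<subseteq> F" "F \<inter> Y = T \<inter> Y"
proof -
  have dT: "dim T \<le> n"
  proof -
    have "dim (span (T \<union> W)) \<le> n + l"
      using dim_subset[OF subset_UNIV, of "span (T \<union> W)"] unfolding dim_V .
    then show ?thesis
      using dim_span_Un_direct[of T W] T subspace_W dim_W by (simp add: transversal_def)
  qed
  have "\<exists>F. transversal F \<and> dim F = k \<and> T \<subseteq> F \<and> F \<inter> Y = T \<inter> Y" if "dim T \<le> k" "k \<le> n" for k
    using that
  proof (induction k rule: dec_induct)
    case base
    then show ?case using T by blast
  next
    case (step k)
    then obtain P where P: "transversal P" "dim P = k" "T \<subseteq> P" "P \<inter> Y = T \<inter> Y"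
      by auto
    have sP: "subspace P" using P transversal_subspace by blast
    have proper: "\<exists>v. v \<notin> span (P \<union> A)" if "subspace A" "dim A \<le> l" for A
    proof -
      have "dim (span (P \<union> A)) < dim UNIV"
        using dim_span_Un_Int[OF sP that(1)] that(2) P(2) step.prems dim_V by linarith
      then show ?thesis by (metis UNIV_eq_I nat_neq_iff)
    qed
    obtain v where v: "v \<notin> span (P \<union> W)" "v \<notin> span (P \<union> Y)"
    proof -
      obtain x where x: "x \<notin> span (P \<union> W)" using proper subspace_W dim_W by blast
      obtain y where y: "y \<notin> span (P \<union> Y)" using proper Y \<open>dim Y \<le> l\<close> by blast
      \<comment> \<open>If \<open>x\<close> lies in \<open>P + Y\<close> and \<open>y\<close> lies
        in \<open>P + W\<close>, then \<open>x + y\<close> lies in neither.\<close>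
      have "\<exists>v \<in> {x, y, x + y}. v \<notin> span (P \<union> W) \<and> v \<notin> span (P \<union> Y)"
        using x y span_add_eq[of x "P \<union> Y" y] span_add_eq2[of y "P \<union> W" x] by blast
      then show ?thesis using that by blast
    qed
    let ?H = "span (insert v P)"
    have "?H \<inter> W = P \<inter> W" "?H \<inter> Y = P \<inter> Y"
      using span_insert_Int[OF sP] v subspace_W Y by blast+
    moreover have "v \<notin> P" using v span_base[of v "P \<union> W"] by blast
    moreover have "P \<subseteq> ?H" using span_superset[of "insert v P"] by blast
    ultimately show ?case
      using P dim_span_insert[OF sP, of v] unfolding transversal_def
      by (intro exI[of _ ?H]) auto
  qed
  from this[OF dT order_refl] show ?thesis using that mem_complements by blast
qed

end

section \<open>Maximal intersecting families\<close>

locale maximal_intersecting_family = attenuated_space scale Basis q W n l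
  for scale :: "'a::{field,finite} \<Rightarrow> 'b::ab_group_add \<Rightarrow> 'b" and Basis q W n l +
  fixes t :: nat and \<F> :: "'b set set"
  assumes family: "\<F> \<subseteq> complements"
    and intersecting: "\<And>F F'. F \<in> \<F> \<Longrightarrow> F' \<in> \<F> \<Longrightarrow> t \<le> dim (F \<inter> F')"
    and maximal: "\<And>A. A \<in> complements \<Longrightarrow> (\<And>F. F \<in> \<F> \<Longrightarrow> t \<le> dim (F \<inter> A)) \<Longrightarrow> A \<in> \<F>"
    and t_ge_1: "1 \<le> t" and t_le: "t + 2 \<le> n" and l_ge: "n + t + 2 \<le> l"
    and nontrivial: "dim (\<Inter>\<F>) < t"
begin

definition covering :: "'b set \<Rightarrow> bool" where
  "covering T \<longleftrightarrow> transversal T \<and> (\<forall>F\<in>\<F>. t \<le> dim (F \<inter> T))"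

lemma family_complement: "F \<in> \<F> \<Longrightarrow> F \<in> complements"
  using family by blast

lemma family_subspace: "F \<in> \<F> \<Longrightarrow> subspace F"
  using family_complement complement_subspace by blast

lemma family_dim: "F \<in> \<F> \<Longrightarrow> dim F = n"
  using family_complement mem_complements by blast

lemma covering_subspace: "covering T \<Longrightarrow> subspace T"
  unfolding covering_def transversal_def by blast

lemma family_covering: "F \<in> \<F> \<Longrightarrow> covering F"
  unfolding covering_def using intersecting family_complement mem_complements by blast

text \<open>A covering \<open>t\<close>-space would lie in every member, hence in their
  intersection, whose dimension is below \<open>t\<close>.\<close>

lemma not_covering_dim_t:
  assumes "dim S = t" shows "\<not> covering S"
proof
  assume S: "covering S"
  have "S \<subseteq> F" if "F \<in> \<F>" for F
  proof -
    have "t \<le> dim (F \<inter> S)" using S that by (simp add: covering_def)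
    then have "F \<inter> S = S"
      using subspace_dim_equal[OF subspace_inter[OF family_subspace[OF that] covering_subspace[OF S]]
          covering_subspace[OF S]] assms by simp
    then show ?thesis by blast
  qed
  then have "S \<subseteq> \<Inter>\<F>" by blast
  then show False using dim_subset[of S "\<Inter>\<F>"] nontrivial assms by simp
qed

text \<open>Every element of \<open>\<G>\<close> meets all of \<open>\<F>\<close> sufficiently, so
  maximality puts it into \<open>\<F>\<close>. Identifying \<open>\<F>\<close> thus takes one
  inclusion and the intersection property of the candidate.\<close>

lemma family_eqI:
  assumes "\<F> \<subseteq> \<G>" "\<G> \<subseteq> complements" "\<And>F F'. F \<in> \<G> \<Longrightarrow> F' \<in> \<G> \<Longrightarrow> t \<le> dim (F \<inter> F')"
  shows "\<F> = \<G>"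
proof (rule subset_antisym[OF assms(1)], rule subsetI)
  fix A assume "A \<in> \<G>"
  then show "A \<in> \<F>" using assms by (intro maximal) auto
qed

section \<open>Bounds on the size of the family\<close>

text \<open>Below dimension \<open>t + d\<close> no \<open>S\<close> is covering, so
  \<open>card_noncover_le\<close> applies at each dimension \<open>t + j\<close> and contributes the
  factor of index \<open>j\<close>. At \<open>t + d\<close> the complements above \<open>S\<close>
  are counted directly.\<close>

lemma card_above_noncovering:
  assumes no: "\<And>T. covering T \<Longrightarrow> t \<le> dim T \<Longrightarrow> t + d \<le> dim T"
    and S: "transversal S" "dim S = t + i" and "i \<le> d"
  shows "real (card {F \<in> \<F>. S \<subseteq> F})
    \<le> (\<Prod>j=i..<d. Q ^ (j + 1) * proj_points Q (n - t - j)) * Q ^ (l * (n - t - d))"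
  using S \<open>i \<le> d\<close>
proof (induction "d - i" arbitrary: i S)
  case 0
  have "i = d" using 0 by simp
  have "real (card {F \<in> \<F>. S \<subseteq> F}) \<le> Q ^ (l * (n - dim S))"
    using family by (intro card_complements_above[OF "0.prems"(1)]) auto
  then show ?case
    unfolding "0.prems"(2) \<open>i = d\<close> by simp
next
  case (Suc k)
  let ?K = "(\<Prod>j=Suc i..<d. Q ^ (j + 1) * proj_points Q (n - t - j)) * Q ^ (l * (n - t - d))"
  have i: "i < d" "k = d - Suc i" using Suc.hyps(2) by simp_all
  have "\<not> covering S" using no[of S] Suc.prems(2) i by auto
  then obtain F' where F': "F' \<in> \<F>" "dim (F' \<inter> S) < t"
    using Suc.prems(1) unfolding covering_def by (meson not_le)
  have "real (card {F \<in> \<F>. S \<subseteq> F}) \<le> Q ^ (dim S - t + 1) * proj_points Q (n - dim S) * ?K"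
  proof (rule card_noncover_le[where t = t and F' = F'])
    fix H assume H: "transversal H" "S \<subseteq> H" "dim H = dim S + 1"
    have "{F \<in> {F \<in> \<F>. S \<subseteq> F}. H \<subseteq> F} = {F \<in> \<F>. H \<subseteq> F}"
      using H by blast
    then show "real (card {F \<in> {F \<in> \<F>. S \<subseteq> F}. H \<subseteq> F}) \<le> ?K"
      using Suc.hyps(1)[OF i(2) H(1)] Suc.prems(2) H(3) i(1) by simp
  next
    show "S \<subseteq> F \<and> t \<le> dim (F \<inter> F')" if "F \<in> {F \<in> \<F>. S \<subseteq> F}" for F
      using that F'(1) intersecting by simp
  qed (use Suc.prems F' family in \<open>auto simp: Int_commute\<close>)
  also have "\<dots> = (\<Prod>j=i..<d. Q ^ (j + 1) * proj_points Q (n - t - j)) * Q ^ (l * (n - t - d))"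
    using i(1) Suc.prems(2) by (simp add: prod.atLeast_Suc_lessThan)
  finally show ?case .
qed

lemma card_le_cover_bound:
  assumes no: "\<And>T. covering T \<Longrightarrow> t \<le> dim T \<Longrightarrow> t + d \<le> dim T"
    and T: "covering T" "dim T = t + d"
  shows "real (card \<F>) \<le> cover_bound Q l n t d"
  unfolding cover_bound_def
proof (rule card_below_cover_le[OF covering_subspace[OF T(1)] T(2) family])
  show "t \<le> dim (F \<inter> T)" if "F \<in> \<F>" for F
    using T that by (simp add: covering_def)
  show "real (card {F \<in> \<F>. S \<subseteq> F})
      \<le> (\<Prod>j<d. Q ^ (j + 1) * proj_points Q (n - t - j)) * Q ^ (l * (n - t - d))"
    if "transversal S" "dim S = t" for S
    using card_above_noncovering[OF no, of S 0] that by (simp add: atLeast0LessThan)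
  show "0 \<le> (\<Prod>j<d. Q ^ (j + 1) * proj_points Q (n - t - j)) * Q ^ (l * (n - t - d))"
    using proj_points_nonneg[OF Q_gt_1] by (intro mult_nonneg_nonneg prod_nonneg) auto
qed

text \<open>Members above some covering \<open>(t + 1)\<close>-space are counted through those
  spaces, which correspond to points of the quotient of \<open>D\<close> by \<open>X\<close>. The
  other members, \<open>G\<close>, are counted from the \<open>t\<close>-subspaces of
  \<open>T1\<close> by two noncovering extension steps.\<close>

lemma card_le_few_covers:
  assumes T1: "covering T1" "dim T1 = t + 1"
    and \<T>: "\<And>T. covering T \<Longrightarrow> dim T = t + 1 \<Longrightarrow> X \<subseteq> T \<and> T \<subseteq> D"
    and X: "subspace X" "dim X = t" and D: "subspace D" "dim D \<le> n - 1"
  shows "real (card \<F>) \<le> proj_points Q (n - t - 1) * Q ^ (l * (n - t - 1))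
    + proj_points Q (t + 1) * (Q * proj_points Q (n - t) * (Q ^ 2 * proj_points Q (n - t - 1) * Q ^ (l * (n - t - 2))))"
proof -
  define \<T>1 where "\<T>1 = {T. covering T \<and> dim T = t + 1}"
  define G where "G = {F \<in> \<F>. \<forall>T\<in>\<T>1. \<not> T \<subseteq> F}"
  have GF: "G \<subseteq> \<F>" by (auto simp: G_def)
  then have GC: "G \<subseteq> complements" using family by blast
  have nn: "0 \<le> Q ^ 2 * proj_points Q (n - t - 1) * Q ^ (l * (n - t - 2))"
    "0 \<le> Q * proj_points Q (n - t) * (Q ^ 2 * proj_points Q (n - t - 1) * Q ^ (l * (n - t - 2)))"
    using proj_points_nonneg[OF Q_gt_1] by (intro mult_nonneg_nonneg; simp)+
  have cT: "real (card \<T>1) \<le> proj_points Q (n - t - 1)"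
  proof -
    have "X \<subseteq> D" using \<T>[OF T1] by blast
    then have "real (card \<T>1) \<le> proj_points Q (dim D - dim X)"
      by (rule card_between_le[OF X(1) D(1)]) (use \<T> X covering_subspace in \<open>auto simp: \<T>1_def\<close>)
    also have "\<dots> \<le> proj_points Q (n - t - 1)"
      unfolding proj_points_def using Q_gt_1 D X
      by (intro divide_right_mono diff_right_mono power_increasing) auto
    finally show ?thesis .
  qed
  have "\<F> - G \<subseteq> (\<Union>T\<in>\<T>1. {F \<in> \<F>. T \<subseteq> F})"
    unfolding G_def by blast
  then have "card (\<F> - G) \<le> card (\<Union>T\<in>\<T>1. {F \<in> \<F>. T \<subseteq> F})"
    by (rule card_mono[rotated]) simp
  also have "\<dots> \<le> (\<Sum>T\<in>\<T>1. card {F \<in> \<F>. T \<subseteq> F})"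
    by (rule card_UN_le) simp
  finally have "real (card (\<F> - G)) \<le> (\<Sum>T\<in>\<T>1. real (card {F \<in> \<F>. T \<subseteq> F}))"
    unfolding of_nat_sum[symmetric] by (rule of_nat_mono)
  also have "\<dots> \<le> (\<Sum>T\<in>\<T>1. Q ^ (l * (n - t - 1)))"
  proof (rule sum_mono)
    fix T assume "T \<in> \<T>1"
    then have T: "transversal T" "dim T = t + 1" by (auto simp: \<T>1_def covering_def)
    have "real (card {F \<in> \<F>. T \<subseteq> F}) \<le> Q ^ (l * (n - dim T))"
      using family by (intro card_complements_above[OF T(1)]) auto
    then show "real (card {F \<in> \<F>. T \<subseteq> F}) \<le> Q ^ (l * (n - t - 1))"
      unfolding T(2) by simp
  qed
  also have "\<dots> \<le> proj_points Q (n - t - 1) * Q ^ (l * (n - t - 1))"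
    using cT by (simp add: mult_right_mono)
  finally have FG: "real (card (\<F> - G)) \<le> proj_points Q (n - t - 1) * Q ^ (l * (n - t - 1))" .
  have "real (card G) \<le> gauss_rec Q 1 t * (Q * proj_points Q (n - t) * (Q ^ 2 * proj_points Q (n - t - 1) * Q ^ (l * (n - t - 2))))"
  proof (rule card_below_cover_le[OF covering_subspace[OF T1(1)] T1(2)])
    show "G \<subseteq> complements" by (rule GC)
    show "t \<le> dim (F \<inter> T1)" if "F \<in> G" for F
      using that T1 by (auto simp: G_def covering_def)
    fix S assume S: "transversal S" "S \<subseteq> T1" "dim S = t"
    obtain F' where F': "F' \<in> \<F>" "dim (F' \<inter> S) < t"
      using S(1) not_covering_dim_t[OF S(3)] unfolding covering_def by (meson not_le)
    have "real (card {F \<in> G. S \<subseteq> F}) \<le> Q ^ (dim S - t + 1) * proj_points Q (n - dim S)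
        * (Q ^ 2 * proj_points Q (n - t - 1) * Q ^ (l * (n - t - 2)))"
    proof (rule card_noncover_le[where t = t and F' = F'])
      fix H assume H: "transversal H" "S \<subseteq> H" "dim H = dim S + 1"
      have e: "{F \<in> {F \<in> G. S \<subseteq> F}. H \<subseteq> F} = {F \<in> G. H \<subseteq> F}"
        using H by blast
      show "real (card {F \<in> {F \<in> G. S \<subseteq> F}. H \<subseteq> F}) \<le> Q ^ 2 * proj_points Q (n - t - 1) * Q ^ (l * (n - t - 2))"
      proof (cases "covering H")
        case True
        \<comment> \<open>By the choice of \<open>G\<close> its members contain no covering
          \<open>(t + 1)\<close>-space, so only noncovering \<open>H\<close> contribute and the
          second extension step is available.\<close>
        then have empty: "{F \<in> G. H \<subseteq> F} = {}"
          using H S by (auto simp: G_def \<T>1_def)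
        show ?thesis unfolding e empty using nn(1) by simp
      next
        case False
        then obtain F2 where F2: "F2 \<in> \<F>" "dim (F2 \<inter> H) < t"
          using H(1) unfolding covering_def by (meson not_le)
        have "real (card {F \<in> G. H \<subseteq> F}) \<le> Q ^ (dim H - t + 1) * proj_points Q (n - dim H) * Q ^ (l * (n - t - 2))"
        proof (rule card_noncover_le[where t = t and F' = F2])
          fix H' assume H': "transversal H'" "H \<subseteq> H'" "dim H' = dim H + 1"
          have "real (card {F \<in> {F \<in> G. H \<subseteq> F}. H' \<subseteq> F}) \<le> Q ^ (l * (n - dim H'))"
            using GC by (intro card_complements_above[OF H'(1)]) auto
          then show "real (card {F \<in> {F \<in> G. H \<subseteq> F}. H' \<subseteq> F}) \<le> Q ^ (l * (n - t - 2))"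
            unfolding H'(3) H(3) S(3) by simp
        next
          show "H \<subseteq> F \<and> t \<le> dim (F \<inter> F2)" if "F \<in> {F \<in> G. H \<subseteq> F}" for F
            using that F2(1) intersecting GF by blast
        qed (use H S F2 GC family in \<open>auto simp: Int_commute\<close>)
        then show ?thesis unfolding e H(3) S(3) by (simp add: numeral_2_eq_2)
      qed
    next
      show "S \<subseteq> F \<and> t \<le> dim (F \<inter> F')" if "F \<in> {F \<in> G. S \<subseteq> F}" for F
        using that F'(1) intersecting GF by blast
    qed (use S F' GC family in \<open>auto simp: Int_commute\<close>)
    then show "real (card {F \<in> G. S \<subseteq> F}) \<le> Q * proj_points Q (n - t) * (Q ^ 2 * proj_points Q (n - t - 1) * Q ^ (l * (n - t - 2)))"
      unfolding S(3) by simp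
  qed (rule nn(2))
  then have "real (card G) \<le> proj_points Q (t + 1) * (Q * proj_points Q (n - t) * (Q ^ 2 * proj_points Q (n - t - 1) * Q ^ (l * (n - t - 2))))"
    unfolding gauss_rec_1[OF Q_gt_1] .
  moreover have "real (card \<F>) = real (card (\<F> - G)) + real (card G)"
  proof -
    have "card (\<F> - G) + card G = card \<F>"
      using card_Diff_subset[of G \<F>] card_mono[of \<F> G] by (auto simp: G_def)
    then show ?thesis by (metis of_nat_add)
  qed
  ultimately show ?thesis using FG by linarith
qed

section \<open>Configurations of covering subspaces\<close>

text \<open>Extend \<open>T\<close> to a complement \<open>F\<close> of \<open>W\<close> that meets
  \<open>T'\<close> only in \<open>T \<inter> T'\<close>. Containing a covering space,
  \<open>F\<close> belongs to \<open>\<F>\<close> by maximality, so \<open>T'\<close> meets it in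
  dimension at least \<open>t\<close>.\<close>

lemma coverings_intersect:
  assumes "covering T" "covering T'" "dim T' \<le> l"
  shows "t \<le> dim (T \<inter> T')"
proof -
  obtain F where F: "F \<in> complements" "T \<subseteq> F" "F \<inter> T' = T \<inter> T'"
    using extend_avoiding[of T T'] assms covering_subspace covering_def by blast
  have "t \<le> dim (F' \<inter> F)" if "F' \<in> \<F>" for F'
  proof -
    have "dim (F' \<inter> T) \<le> dim (F' \<inter> F)" using F by (intro dim_subset) blast
    then show ?thesis using assms(1) that unfolding covering_def by force
  qed
  then have "F \<in> \<F>" by (rule maximal[OF F(1)])
  then show ?thesis using assms(2) F unfolding covering_def by metis
qed

lemma coverings_dim_Int:
  assumes "covering T1" "covering T2" "dim T1 = t + 1" "dim T2 = t + 1" "T1 \<noteq> T2"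
  shows "dim (T1 \<inter> T2) = t"
proof (rule ccontr)
  assume "dim (T1 \<inter> T2) \<noteq> t"
  moreover have "t \<le> dim (T1 \<inter> T2)"
    using assms l_ge by (intro coverings_intersect) auto
  ultimately have "t + 1 \<le> dim (T1 \<inter> T2)" by simp
  moreover have sub: "subspace T1" "subspace T2" "subspace (T1 \<inter> T2)"
    using assms(1,2) covering_subspace subspace_inter by auto
  ultimately have "T1 \<inter> T2 = T1" "T1 \<inter> T2 = T2"
    using subspace_dim_equal[OF sub(3,1)] subspace_dim_equal[OF sub(3,2)] assms(3,4) by auto
  then show False using \<open>T1 \<noteq> T2\<close> by blast
qed

text \<open>The empty intersection is the whole space, whose dimension exceeds
  \<open>t\<close>.\<close>

lemma family_nonempty: "\<F> \<noteq> {}"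
proof
  assume "\<F> = {}"
  then have "dim (\<Inter>\<F>) = n + l" using dim_V by simp
  then show False using nontrivial t_le by linarith
qed

lemma H3_intersecting:
  assumes Z: "subspace Z" "dim Z = t + 2" and F: "F \<in> H3 scale W n t Z" "F' \<in> H3 scale W n t Z"
  shows "t \<le> dim (F \<inter> F')"
proof -
  have sub: "subspace (F \<inter> Z)" "subspace (F' \<inter> Z)"
    using F Z complement_subspace subspace_inter by (auto simp: H3_def)
  have "dim (F \<inter> Z) + dim (F' \<inter> Z) \<le> dim ((F \<inter> Z) \<inter> (F' \<inter> Z)) + dim Z"
    by (rule dim_Int_ge[OF sub Z(1)]) auto
  moreover have "dim ((F \<inter> Z) \<inter> (F' \<inter> Z)) \<le> dim (F \<inter> F')"
    by (rule dim_subset) blast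
  moreover have "t + 1 \<le> dim (F \<inter> Z)" "t + 1 \<le> dim (F' \<inter> Z)"
    using F by (auto simp: H3_def)
  ultimately show ?thesis using Z(2) by linarith
qed

text \<open>\<open>Z = T1 + T2\<close> has dimension \<open>t + 2\<close> and contains
  \<open>T3\<close>, which is spanned by its intersections with \<open>T1\<close> and
  \<open>T2\<close>. A member meeting \<open>Z\<close> only in dimension \<open>t\<close> would meet
  all three in the same \<open>t\<close>-space, namely \<open>T1 \<inter> T2\<close>, which is not
  inside \<open>T3\<close>.\<close>

lemma family_eq_H3:
  assumes T: "covering T1" "covering T2" "covering T3"
    "dim T1 = t + 1" "dim T2 = t + 1" "dim T3 = t + 1"
    and "T1 \<noteq> T2" "\<not> T1 \<inter> T2 \<subseteq> T3"
  obtains Z where "subspace Z" "dim Z = t + 2" "dim (Z \<inter> W) \<le> 1" "\<F> = H3 scale W n t Z"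
proof -
  define Z where "Z = span (T1 \<union> T2)"
  have sT: "subspace T1" "subspace T2" "subspace T3"
    using T covering_subspace by auto
  have sZ: "subspace Z" by (simp add: Z_def)
  have TZ: "T1 \<subseteq> Z" "T2 \<subseteq> Z" unfolding Z_def using span_superset[of "T1 \<union> T2"] by auto
  have ge: "t \<le> dim (T1 \<inter> T2)" "t \<le> dim (T3 \<inter> T1)" "t \<le> dim (T3 \<inter> T2)"
    using T l_ge by (intro coverings_intersect; simp)+
  have sI: "subspace (T1 \<inter> T2)" "subspace (T3 \<inter> T1)" "subspace (T3 \<inter> T2)"
    using sT by (auto intro: subspace_inter)
  have dX: "dim (T1 \<inter> T2) = t"
    by (rule coverings_dim_Int[OF T(1,2,4,5) \<open>T1 \<noteq> T2\<close>])
  have dZ: "dim Z = t + 2"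
    using dim_span_Un_Int[OF sT(1,2)] dX T(4,5) by (simp add: Z_def)
  have TX: "A = T1 \<inter> T2" if "subspace A" "t \<le> dim A" "A \<subseteq> T1" "A \<subseteq> T2" for A
    using subspace_dim_equal[OF that(1) sI(1)] that dX by simp
  have "T3 \<subseteq> Z"
  proof -
    \<comment> \<open>Otherwise \<open>T3 \<inter> T1\<close> would lie in
      \<open>T1 \<inter> T2\<close>, equal it by dimension, and put it inside
      \<open>T3\<close>.\<close>
    have "\<not> T3 \<inter> T1 \<subseteq> T3 \<inter> T2"
      using TX[OF sI(2) ge(2)] \<open>\<not> T1 \<inter> T2 \<subseteq> T3\<close> by blast
    then have "span ((T3 \<inter> T2) \<union> (T3 \<inter> T1)) \<noteq> T3 \<inter> T2"
      using span_superset[of "(T3 \<inter> T2) \<union> (T3 \<inter> T1)"] by blast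
    moreover have "T3 \<inter> T2 \<subseteq> span ((T3 \<inter> T2) \<union> (T3 \<inter> T1))"
      using span_superset[of "(T3 \<inter> T2) \<union> (T3 \<inter> T1)"] by blast
    ultimately have "\<not> dim (span ((T3 \<inter> T2) \<union> (T3 \<inter> T1))) \<le> dim (T3 \<inter> T2)"
      using subspace_dim_equal[OF sI(3) subspace_span, of "(T3 \<inter> T2) \<union> (T3 \<inter> T1)"] by blast
    then have "dim T3 \<le> dim (span ((T3 \<inter> T2) \<union> (T3 \<inter> T1)))"
      using ge T(6) by linarith
    moreover have "span ((T3 \<inter> T2) \<union> (T3 \<inter> T1)) \<subseteq> T3"
      by (rule span_Un_subset[OF sT(3)]) auto
    ultimately have "span ((T3 \<inter> T2) \<union> (T3 \<inter> T1)) = T3"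
      using subspace_dim_equal[OF subspace_span sT(3)] by blast
    moreover have "span ((T3 \<inter> T2) \<union> (T3 \<inter> T1)) \<subseteq> Z"
      by (rule span_Un_subset[OF sZ]) (use TZ in auto)
    ultimately show ?thesis by simp
  qed
  have FZ: "t + 1 \<le> dim (F \<inter> Z)" if F: "F \<in> \<F>" for F
  proof (rule ccontr)
    assume "\<not> t + 1 \<le> dim (F \<inter> Z)"
    then have le: "dim (F \<inter> Z) \<le> t" by simp
    have sF: "subspace F" by (rule family_subspace[OF F])
    have eq: "F \<inter> T = F \<inter> Z" if "covering T" "T \<subseteq> Z" for T
    proof (rule subspace_dim_equal)
      show "dim (F \<inter> Z) \<le> dim (F \<inter> T)"
        using that F le unfolding covering_def by force
    qed (use that sF sZ covering_subspace in \<open>auto intro: subspace_inter\<close>)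
    have "F \<inter> Z = T1 \<inter> T2"
    proof (rule TX)
      show "subspace (F \<inter> Z)" using sF sZ by (rule subspace_inter)
      show "t \<le> dim (F \<inter> Z)" using eq[OF T(1) TZ(1)] T(1) F unfolding covering_def by force
      show "F \<inter> Z \<subseteq> T1" "F \<inter> Z \<subseteq> T2" using eq T TZ by blast+
    qed
    then show False using eq[OF T(3) \<open>T3 \<subseteq> Z\<close>] \<open>\<not> T1 \<inter> T2 \<subseteq> T3\<close> by blast
  qed
  obtain F where F: "F \<in> \<F>" using family_nonempty by blast
  \<comment> \<open>\<open>F \<inter> Z\<close> and \<open>Z \<inter> W\<close> meet trivially
    inside \<open>Z\<close>, and the first has codimension at most 1.\<close>
  have "dim (F \<inter> Z) + dim (Z \<inter> W) \<le> dim ((F \<inter> Z) \<inter> (Z \<inter> W)) + dim Z"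
    using family_subspace[OF F] sZ subspace_W by (intro dim_Int_ge subspace_inter) auto
  moreover have "dim ((F \<inter> Z) \<inter> (Z \<inter> W)) = 0"
    using family_complement[OF F] unfolding mem_complements transversal_def dim_eq_0 by blast
  ultimately have "dim (Z \<inter> W) \<le> 1" using FZ[OF F] dZ by linarith
  moreover have "\<F> = H3 scale W n t Z"
  proof (rule family_eqI)
    show "\<F> \<subseteq> H3 scale W n t Z" using FZ family by (auto simp: H3_def)
    show "H3 scale W n t Z \<subseteq> complements" by (auto simp: H3_def)
  qed (rule H3_intersecting[OF sZ dZ])
  ultimately show ?thesis using that sZ dZ by blast
qed

text \<open>This is \<open>card_below_cover_le\<close> with \<open>t + 1\<close> in the role of
  \<open>t\<close> and \<open>d = 1\<close>.\<close>

lemma card_H3_le: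
  assumes Z: "subspace Z" "dim Z = t + 2"
  shows "real (card (H3 scale W n t Z)) \<le> proj_points Q (t + 2) * Q ^ (l * (n - t - 1))"
proof -
  have H3: "H3 scale W n t Z \<subseteq> complements" by (auto simp: H3_def)
  have "real (card (H3 scale W n t Z)) \<le> gauss_rec Q 1 (t + 1) * Q ^ (l * (n - t - 1))"
  proof (rule card_below_cover_le[OF Z(1) _ H3])
    show "dim Z = t + 1 + 1" using Z by simp
    show "t + 1 \<le> dim (F \<inter> Z)" if "F \<in> H3 scale W n t Z" for F
      using that by (simp add: H3_def)
    fix S assume S: "transversal S" "dim S = t + 1"
    have "real (card {F \<in> H3 scale W n t Z. S \<subseteq> F}) \<le> Q ^ (l * (n - dim S))"
      using H3 by (intro card_complements_above[OF S(1)]) auto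
    then show "real (card {F \<in> H3 scale W n t Z. S \<subseteq> F}) \<le> Q ^ (l * (n - t - 1))"
      unfolding S(2) by simp
  qed simp
  then show ?thesis unfolding gauss_rec_1[OF Q_gt_1] by simp
qed

text \<open>Only transversal \<open>(t + 1)\<close>-subspaces of \<open>Z\<close> can lie in a
  member. They are the complements in \<open>Z\<close> of the line \<open>Z \<inter> W\<close>,
  hence at most \<open>Q ^ (t + 1)\<close> many, which improves on
  \<open>proj_points Q (t + 2)\<close>.\<close>

lemma card_H3_type_1_le:
  assumes Z: "subspace Z" "dim Z = t + 2" "dim (Z \<inter> W) = 1"
  shows "real (card (H3 scale W n t Z)) \<le> Q ^ (t + 1) * Q ^ (l * (n - t - 1))"
proof -
  define \<S> where "\<S> = {S. transversal S \<and> S \<subseteq> Z \<and> dim S = t + 1}"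
  have H3: "H3 scale W n t Z \<subseteq> complements" by (auto simp: H3_def)
  have "real (card \<S>) \<le> Q ^ (dim (Z \<inter> W) * (t + 1 - dim {0}))"
  proof (rule card_complements[OF _ Z(1)])
    show "subspace (Z \<inter> W)" using Z subspace_W by (intro subspace_inter)
    show "dim Z = t + 1 + dim (Z \<inter> W)" using Z by simp
    show "{0} \<subseteq> Z" using subspace_0[OF Z(1)] by simp
    fix S assume "S \<in> \<S>"
    then have S: "transversal S" "S \<subseteq> Z" "dim S = t + 1" by (auto simp: \<S>_def)
    then show "subspace S \<and> S \<subseteq> Z \<and> {0} \<subseteq> S \<and> dim S = t + 1 \<and> S \<inter> (Z \<inter> W) \<subseteq> {0}"
      using subspace_0[of S] unfolding transversal_def by blast
  qed auto
  then have cS: "real (card \<S>) \<le> Q ^ (t + 1)" using Z(3) by simp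
  have "H3 scale W n t Z \<subseteq> (\<Union>S\<in>\<S>. {F \<in> H3 scale W n t Z. S \<subseteq> F})"
  proof
    fix F assume F: "F \<in> H3 scale W n t Z"
    then have FC: "F \<in> complements" and d: "t + 1 \<le> dim (F \<inter> Z)" by (auto simp: H3_def)
    have "subspace (F \<inter> Z)" using FC Z complement_subspace by (intro subspace_inter) auto
    then obtain S where S: "subspace S" "S \<subseteq> F \<inter> Z" "dim S = t + 1"
      using choose_subspace_of_subspace[OF d] span_eq_iff[THEN iffD2] by metis
    then have "transversal S" using FC transversal_subset[of F S] by (auto simp: mem_complements)
    then have "S \<in> \<S>" using S by (auto simp: \<S>_def)
    then show "F \<in> (\<Union>S\<in>\<S>. {F \<in> H3 scale W n t Z. S \<subseteq> F})" using S F by blast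
  qed
  then have "card (H3 scale W n t Z) \<le> card (\<Union>S\<in>\<S>. {F \<in> H3 scale W n t Z. S \<subseteq> F})"
    by (rule card_mono[rotated]) simp
  also have "\<dots> \<le> (\<Sum>S\<in>\<S>. card {F \<in> H3 scale W n t Z. S \<subseteq> F})"
    by (rule card_UN_le) simp
  finally have "real (card (H3 scale W n t Z)) \<le> (\<Sum>S\<in>\<S>. real (card {F \<in> H3 scale W n t Z. S \<subseteq> F}))"
    unfolding of_nat_sum[symmetric] by (rule of_nat_mono)
  also have "\<dots> \<le> (\<Sum>S\<in>\<S>. Q ^ (l * (n - t - 1)))"
  proof (rule sum_mono)
    fix S assume "S \<in> \<S>"
    then have S: "transversal S" "dim S = t + 1" by (auto simp: \<S>_def)
    have "real (card {F \<in> H3 scale W n t Z. S \<subseteq> F}) \<le> Q ^ (l * (n - dim S))"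
      using H3 by (intro card_complements_above[OF S(1)]) auto
    then show "real (card {F \<in> H3 scale W n t Z. S \<subseteq> F}) \<le> Q ^ (l * (n - t - 1))"
      unfolding S(2) by simp
  qed
  also have "\<dots> \<le> Q ^ (t + 1) * Q ^ (l * (n - t - 1))"
    using mult_right_mono[OF cS, of "Q ^ (l * (n - t - 1))"] by simp
  finally show ?thesis .
qed

section \<open>Families with a common center\<close>

text \<open>Members of the first two classes share \<open>X\<close>. A member of the third class
  meets one of the first inside \<open>M\<close> in dimension at least
  \<open>(t + 1) + (n - 1) - n\<close>, and one of the second inside \<open>C\<close> in dimension
  at least \<open>(dim C - n + t) + n - dim C\<close>; both equal \<open>t\<close>.\<close>

lemma H2_intersecting:
  assumes X: "subspace X" "dim X = t" and M: "subspace M" "dim M = n" "X \<subseteq> M"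
    and C: "subspace C" "M \<subseteq> C"
    and F: "F \<in> H2 scale W n t X M C" and F': "F' \<in> H2 scale W n t X M C"
  shows "t \<le> dim (F \<inter> F')"
proof -
  let ?A = "{F \<in> complements. X \<subseteq> F \<and> t + 1 \<le> dim (F \<inter> M)}"
  let ?B = "{F \<in> complements. F \<inter> M = X \<and> dim (F \<inter> C) = dim C - n + t}"
  let ?C = "{F \<in> complements. F \<subseteq> C \<and> dim (F \<inter> M) = n - 1}"
  have dC: "n \<le> dim C" using dim_subset[OF C(2)] M by simp
  have sub: "H2 scale W n t X M C \<subseteq> ?A \<union> ?B \<union> ?C"
    unfolding H2_def typed_subspaces_def by blast
  have XX: "t \<le> dim (F \<inter> F')" if "X \<subseteq> F" "X \<subseteq> F'" for F F'
    using dim_subset[of X "F \<inter> F'"] that X by simp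
  have AC: "t \<le> dim (F \<inter> F')"
    if "F \<in> complements" "F' \<in> complements" "t + 1 \<le> dim (F \<inter> M)" "dim (F' \<inter> M) = n - 1" for F F'
  proof -
    have "dim (F \<inter> M) + dim (F' \<inter> M) \<le> dim ((F \<inter> M) \<inter> (F' \<inter> M)) + dim M"
      using that complement_subspace M by (intro dim_Int_ge subspace_inter) auto
    moreover have "dim ((F \<inter> M) \<inter> (F' \<inter> M)) \<le> dim (F \<inter> F')"
      by (rule dim_subset) blast
    ultimately show ?thesis using that M t_le by linarith
  qed
  have BC: "t \<le> dim (F \<inter> F')"
    if "F \<in> complements" "F' \<in> complements" "dim (F \<inter> C) = dim C - n + t" "F' \<subseteq> C" for F F'
  proof -
    have "dim (F \<inter> C) + dim F' \<le> dim ((F \<inter> C) \<inter> F') + dim C"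
      using that complement_subspace C by (intro dim_Int_ge subspace_inter) auto
    moreover have "dim ((F \<inter> C) \<inter> F') \<le> dim (F \<inter> F')"
      by (rule dim_subset) blast
    moreover have "dim F' = n" using that mem_complements by blast
    ultimately show ?thesis using that dC by linarith
  qed
  \<comment> \<open>\<open>AC\<close> applies to two members of the third class because
    \<open>t + 1 \<le> n - 1\<close>.\<close>
  have CC: "t \<le> dim (F \<inter> F')" if "F \<in> ?C" "F' \<in> ?C" for F F'
    using AC[of F F'] that t_le by simp
  have dir: "t \<le> dim (F \<inter> F')" if "F \<in> ?A \<union> ?B" "F' \<in> ?C" for F F'
    using that AC[of F F'] BC[of F F'] by auto
  from F F' sub have "F \<in> ?A \<union> ?B \<or> F \<in> ?C" "F' \<in> ?A \<union> ?B \<or> F' \<in> ?C" by blast+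
  then show ?thesis
  proof (elim disjE)
    assume "F \<in> ?A \<union> ?B" "F' \<in> ?A \<union> ?B"
    then show ?thesis by (intro XX) blast+
  next
    assume "F \<in> ?A \<union> ?B" "F' \<in> ?C"
    then show ?thesis by (rule dir)
  next
    assume "F \<in> ?C" "F' \<in> ?A \<union> ?B"
    then have "t \<le> dim (F' \<inter> F)" using dir by blast
    then show ?thesis by (simp add: Int_commute)
  next
    assume "F \<in> ?C" "F' \<in> ?C"
    then show ?thesis by (rule CC)
  qed
qed

text \<open>For a member \<open>F\<close> off \<open>X\<close>, the space \<open>X + F\<close> has
  dimension \<open>n + 1\<close> and contains \<open>M\<close> as a hyperplane, so \<open>F\<close>
  meets \<open>M\<close> in dimension \<open>n - 1\<close>. \<open>C\<close> collects
  \<open>M\<close> and these members when some member meets \<open>M\<close> exactly in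
  \<open>X\<close>, and is the whole space otherwise.\<close>

lemma family_eq_H2:
  assumes X: "transversal X" "dim X = t" and M: "subspace M" "dim M = n" "X \<subseteq> M"
    and off: "\<And>F. F \<in> \<F> \<Longrightarrow> \<not> X \<subseteq> F \<Longrightarrow> dim (F \<inter> X) = t - 1 \<and> M \<subseteq> span (X \<union> F)"
  shows "\<exists>C k c. has_type scale W n k M \<and> has_type scale W c (c - n) C \<and> M \<subseteq> C
    \<and> k \<in> {0, 1} \<and> c \<in> {n + 1..2 * n - t} \<union> {n + l} \<and> \<F> = H2 scale W n t X M C"
proof -
  have sX: "subspace X" using X transversal_subspace by blast
  obtain F0 where F0: "F0 \<in> \<F>" "\<not> X \<subseteq> F0"
  proof -
    have "\<exists>F\<in>\<F>. \<not> X \<subseteq> F"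
    proof (rule ccontr)
      assume "\<not> ?thesis"
      then have "F \<inter> X = X" if "F \<in> \<F>" for F using that by blast
      then have "covering X" using X by (simp add: covering_def)
      then show False using not_covering_dim_t[OF X(2)] by blast
    qed
    then show ?thesis using that by blast
  qed
  have dE: "dim (span (X \<union> F)) = n + 1" if "F \<in> \<F>" "\<not> X \<subseteq> F" for F
  proof -
    have "dim (X \<inter> F) = t - 1" using off[OF that] by (simp add: Int_commute)
    then show ?thesis
      using dim_span_Un_Int[OF sX family_subspace[OF that(1)]] X(2) family_dim[OF that(1)] t_ge_1 by linarith
  qed
  have dFM: "dim (F \<inter> M) = n - 1" if F: "F \<in> \<F>" "\<not> X \<subseteq> F" for F
  proof -
    have sF: "subspace F" by (rule family_subspace[OF F(1)])
    have "dim F + dim M \<le> dim (F \<inter> M) + dim (span (X \<union> F))"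
      using off[OF F] span_superset[of "X \<union> F"] sF M(1) by (intro dim_Int_ge) auto
    then have "n - 1 \<le> dim (F \<inter> M)" using dE[OF F] M(2) family_dim[OF F(1)] by linarith
    moreover have "\<not> n \<le> dim (F \<inter> M)"
    proof
      assume "n \<le> dim (F \<inter> M)"
      then have "F \<inter> M = F" "F \<inter> M = M"
        using subspace_dim_equal[OF subspace_inter[OF sF M(1)] sF]
          subspace_dim_equal[OF subspace_inter[OF sF M(1)] M(1)] family_dim[OF F(1)] M(2) by auto
      then show False using F(2) M(3) by blast
    qed
    ultimately show ?thesis by linarith
  qed
  \<comment> \<open>\<open>X + F0\<close> contains a complement of \<open>W\<close> and has
    dimension \<open>n + 1\<close>, so it meets \<open>W\<close> in a line, and \<open>M\<close>
    lies inside it.\<close>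
  have typeM: "dim (M \<inter> W) \<le> 1"
  proof -
    have "dim (span (X \<union> F0)) = n + dim (span (X \<union> F0) \<inter> W)"
      using span_superset[of "X \<union> F0"]
      by (intro dim_above_complement[OF family_complement[OF F0(1)]]) auto
    moreover have "dim (M \<inter> W) \<le> dim (span (X \<union> F0) \<inter> W)"
      using off[OF F0] by (intro dim_subset) blast
    ultimately show ?thesis using dE[OF F0] by linarith
  qed
  then obtain k where k: "has_type scale W n k M" "k \<in> {0, 1}"
    using M by (cases "dim (M \<inter> W)") (auto simp: has_type_def)
  have eq: "\<F> = H2 scale W n t X M C"
    if C: "subspace C" "M \<subseteq> C"
      and C1: "\<And>F. F \<in> \<F> \<Longrightarrow> \<not> X \<subseteq> F \<Longrightarrow> F \<subseteq> C"
      and C2: "\<And>F. F \<in> \<F> \<Longrightarrow> F \<inter> M = X \<Longrightarrow> dim (F \<inter> C) = dim C - n + t" for C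
  proof (rule family_eqI)
    show "H2 scale W n t X M C \<subseteq> complements"
      unfolding H2_def typed_subspaces_def by blast
    show "\<F> \<subseteq> H2 scale W n t X M C"
    proof
      fix F assume F: "F \<in> \<F>"
      note FC = family_complement[OF F]
      show "F \<in> H2 scale W n t X M C"
      proof (cases "X \<subseteq> F")
        case False
        then have "F \<in> typed_subspaces scale W C n 0"
          using FC C1[OF F] unfolding typed_subspaces_def by blast
        then show ?thesis
          using off[OF F False] dFM[OF F False] unfolding H2_def by blast
      next
        case XF: True
        show ?thesis
        proof (cases "F \<inter> M = X")
          case True
          then show ?thesis using FC C2[OF F] unfolding H2_def by blast
        next
          case False
          have "\<not> dim (F \<inter> M) \<le> dim X"
            using subspace_dim_equal[OF sX subspace_inter[OF family_subspace[OF F] M(1)]] XF M(3) False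
            by blast
          then have "t + 1 \<le> dim (F \<inter> M)" using X(2) by simp
          then show ?thesis using FC XF unfolding H2_def by blast
        qed
      qed
    qed
  qed (rule H2_intersecting[OF sX X(2) M C])
  show ?thesis
  proof (cases "\<exists>F\<in>\<F>. F \<inter> M = X")
    case False
    \<comment> \<open>No member meets \<open>M\<close> exactly in \<open>X\<close>, so the dimension
      condition on \<open>C\<close> is vacuous; this is the case \<open>c = n + l\<close>.\<close>
    have "\<F> = H2 scale W n t X M UNIV"
      by (rule eq) (use False in auto)
    moreover have "has_type scale W (n + l) (n + l - n) UNIV"
      unfolding has_type_def using dim_V dim_W by simp
    ultimately show ?thesis using k by blast
  next
    case True
    define C where "C = span (M \<union> \<Union>{F \<in> \<F>. \<not> X \<subseteq> F})"
    have sC: "subspace C" by (simp add: C_def)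
    have MC: "M \<subseteq> C" and FC: "\<And>F. F \<in> \<F> \<Longrightarrow> \<not> X \<subseteq> F \<Longrightarrow> F \<subseteq> C"
      unfolding C_def using span_superset[of "M \<union> \<Union>{F \<in> \<F>. \<not> X \<subseteq> F}"] by blast+
    \<comment> \<open>The point is \<open>C = M + (F \<inter> C)\<close>. For \<open>F'\<close> off
      \<open>X\<close>, the member \<open>F\<close> contains \<open>X + (F \<inter> F')\<close>, of
      dimension at least \<open>t + 1\<close> inside \<open>?E = X + F'\<close>. As
      \<open>F \<inter> M\<close> has dimension only \<open>t\<close>, \<open>F\<close> leaves the
      hyperplane \<open>M\<close> of \<open>?E\<close>, so \<open>M\<close> and
      \<open>F \<inter> ?E\<close> span \<open>?E\<close>.\<close>
    have C2: "dim C + t = dim (F \<inter> C) + n" if F: "F \<in> \<F>" "F \<inter> M = X" for F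
    proof -
      have sF: "subspace F" by (rule family_subspace[OF F(1)])
      have "F' \<subseteq> span (M \<union> (F \<inter> C))" if F': "F' \<in> \<F>" "\<not> X \<subseteq> F'" for F'
      proof -
        let ?E = "span (X \<union> F')"
        have sF': "subspace F'" by (rule family_subspace[OF F'(1)])
        have EC: "?E \<subseteq> C" using M(3) MC FC[OF F'] by (intro span_Un_subset[OF sC]) auto
        have "dim (X \<inter> (F \<inter> F')) \<le> dim (F' \<inter> X)" by (rule dim_subset) blast
        then have "dim (X \<inter> (F \<inter> F')) \<le> t - 1" using off[OF F'] by simp
        then have "t + 1 \<le> dim (span (X \<union> (F \<inter> F')))"
          using dim_span_Un_Int[OF sX subspace_inter[OF sF sF']] X(2) intersecting[OF F(1) F'(1)] t_ge_1
          by linarith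
        moreover have "span (X \<union> (F \<inter> F')) \<subseteq> F \<inter> ?E"
          using F(2) span_superset[of "X \<union> F'"] sF by (intro span_Un_subset subspace_inter) auto
        ultimately have 1: "t + 1 \<le> dim (F \<inter> ?E)" using dim_subset le_trans by blast
        have "M \<inter> (F \<inter> ?E) \<subseteq> X" using F(2) by blast
        then have "dim (M \<inter> (F \<inter> ?E)) \<le> t" using dim_subset X(2) by blast
        then have "n + 1 \<le> dim (span (M \<union> (F \<inter> ?E)))"
          using 1 dim_span_Un_Int[OF M(1) subspace_inter[OF sF subspace_span], of "X \<union> F'"] M(2) by linarith
        moreover have "span (M \<union> (F \<inter> ?E)) \<subseteq> ?E"
          using off[OF F'] by (intro span_Un_subset) auto
        ultimately have "span (M \<union> (F \<inter> ?E)) = ?E"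
          using subspace_dim_equal[OF subspace_span subspace_span] dE[OF F'] by simp
        moreover have "span (M \<union> (F \<inter> ?E)) \<subseteq> span (M \<union> (F \<inter> C))"
          using EC by (intro span_mono) blast
        ultimately show ?thesis using span_superset[of "X \<union> F'"] by blast
      qed
      then have "C \<subseteq> span (M \<union> (F \<inter> C))"
        using span_superset[of "M \<union> (F \<inter> C)"]
        by (subst C_def) (intro span_minimal; blast)
      moreover have "span (M \<union> (F \<inter> C)) \<subseteq> C"
        using MC by (intro span_Un_subset[OF sC]) auto
      ultimately have "span (M \<union> (F \<inter> C)) = C" by blast
      moreover have "M \<inter> (F \<inter> C) = X" using F(2) MC by blast
      ultimately show ?thesis
        using dim_span_Un_Int[OF M(1) subspace_inter[OF sF sC]] X(2) M(2) by simp
    qed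
    have dC: "n \<le> dim C" using dim_subset[OF MC] M by simp
    have "\<F> = H2 scale W n t X M C"
    proof (rule eq[OF sC MC FC])
      fix F assume "F \<in> \<F>" "F \<inter> M = X"
      from C2[OF this] dC show "dim (F \<inter> C) = dim C - n + t" by linarith
    qed
    moreover have "has_type scale W (dim C) (dim C - n) C"
      using dim_above_complement[OF family_complement[OF F0(1)] sC FC[OF F0]] sC
      unfolding has_type_def by simp
    moreover have "dim C \<in> {n + 1..2 * n - t}"
    proof -
      have "span (X \<union> F0) \<subseteq> C"
        using M(3) MC FC[OF F0] by (intro span_Un_subset[OF sC]) auto
      then have "n + 1 \<le> dim C" using dim_subset dE[OF F0] by metis
      moreover obtain F where F: "F \<in> \<F>" "F \<inter> M = X" using True by blast
      then have "dim (F \<inter> C) \<le> n" using dim_subset[of "F \<inter> C" F] family_dim[OF F(1)] by simp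
      then have "dim C \<le> 2 * n - t" using C2[OF F] by linarith
      ultimately show ?thesis by simp
    qed
    ultimately show ?thesis using k MC by blast
  qed
qed

text \<open>\<open>X\<close> and \<open>F \<inter> T\<close> are distinct hyperplanes of
  \<open>T\<close>, so together they span \<open>T\<close> and they meet in dimension
  \<open>t - 1\<close>.\<close>

lemma meets_center:
  assumes T: "covering T" "dim T = t + 1" "X \<subseteq> T" and X: "subspace X" "dim X = t"
    and F: "F \<in> \<F>" "\<not> X \<subseteq> F"
  shows "dim (F \<inter> X) = t - 1 \<and> T \<subseteq> span (X \<union> F)"
proof -
  have sub: "subspace F" "subspace T" "subspace (F \<inter> T)" "subspace (F \<inter> X)"
    using family_subspace[OF F(1)] covering_subspace[OF T(1)] X(1) subspace_inter by auto
  have FT: "t \<le> dim (F \<inter> T)" using T(1) F(1) by (simp add: covering_def)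
  have "dim (F \<inter> T) + dim X \<le> dim ((F \<inter> T) \<inter> X) + dim T"
    using sub X(1) T(3) by (intro dim_Int_ge) auto
  moreover have "(F \<inter> T) \<inter> X = F \<inter> X" using T(3) by blast
  moreover have "\<not> dim X \<le> dim (F \<inter> X)"
    using subspace_dim_equal[OF sub(4) X(1)] F(2) by blast
  ultimately have FX: "dim (F \<inter> X) = t - 1" using FT T(2) X(2) by simp
  have "X \<inter> (F \<inter> T) = F \<inter> X" using T(3) by blast
  then have "t + 1 \<le> dim (span (X \<union> (F \<inter> T)))"
    using dim_span_Un_Int[OF X(1) sub(3)] FX FT X(2) t_ge_1 by simp
  moreover have "span (X \<union> (F \<inter> T)) \<subseteq> T"
    using T(3) by (intro span_Un_subset[OF sub(2)]) auto
  ultimately have "span (X \<union> (F \<inter> T)) = T"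
    using subspace_dim_equal[OF subspace_span sub(2)] T(2) by simp
  moreover have "span (X \<union> (F \<inter> T)) \<subseteq> span (X \<union> F)"
    by (intro span_mono) blast
  ultimately show ?thesis using FX by simp
qed

lemma large_family_cases:
  assumes range: "Q = 2 \<and> n + t + 4 \<le> l \<or> Q \<ge> 3 \<and> n + t + 2 \<le> l"
    and size: "size_threshold Q l (n - t - 1) \<le> real (card \<F>)"
  shows
    "(\<exists>X M C k c. has_type scale W t 0 X \<and> has_type scale W n k M \<and> has_type scale W c (c - n) C
        \<and> X \<subseteq> M \<and> M \<subseteq> C \<and> k \<in> {0, 1} \<and> c \<in> {n + 1..2 * n - t} \<union> {n + l}
        \<and> \<F> = H2 scale W n t X M C)
   \<or> (\<exists>Z. has_type scale W (t + 2) 0 Z \<and> \<F> = H3 scale W n t Z \<and> n \<le> 2 * t + 2)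
   \<or> (\<exists>Z. has_type scale W (t + 2) 1 Z \<and> \<F> = H3 scale W n t Z \<and> n \<le> 2 * t + 1)"
proof -
  \<comment> \<open>Members of \<open>\<F>\<close> are themselves covering, of dimension
    \<open>n\<close>; hence \<open>d\<close> exists and is at most \<open>n - t\<close>.\<close>
  define d where "d = (LEAST d. \<exists>T. covering T \<and> dim T = t + d)"
  obtain F where F: "F \<in> \<F>" using family_nonempty by blast
  have "\<exists>T. covering T \<and> dim T = t + (n - t)"
    using family_covering[OF F] family_dim[OF F] t_le by (intro exI[of _ F]) simp
  then have "\<exists>T. covering T \<and> dim T = t + d" and dn: "d \<le> n - t"
    unfolding d_def by (rule LeastI, rule Least_le)
  then obtain T1 where T1: "covering T1" "dim T1 = t + d" by blast
  have least: "t + d \<le> dim T" if "covering T" "t \<le> dim T" for T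
  proof -
    have "covering T \<and> dim T = t + (dim T - t)" using that by simp
    then have "d \<le> dim T - t" unfolding d_def by (intro Least_le exI)
    then show ?thesis using that by linarith
  qed
  have "d \<noteq> 0" using not_covering_dim_t[of T1] T1 by auto
  moreover have "\<not> 2 \<le> d"
  proof
    assume "2 \<le> d"
    have "real (card \<F>) \<le> cover_bound Q l n t d"
      by (rule card_le_cover_bound[OF least T1])
    also have "\<dots> \<le> cover_bound Q l n t 2"
      using \<open>2 \<le> d\<close> dn t_le l_ge t_ge_1 q_ge_2 by (intro cover_bound_antimono) auto
    also have "\<dots> < size_threshold Q l (n - t - 1)"
      by (rule cover_bound_less_threshold[OF t_ge_1 t_le range])
    finally show False using size by simp
  qed
  ultimately have "d = 1" by simp
  then have dT1: "dim T1 = t + 1" using T1 by simp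
  show ?thesis
  proof (cases "\<exists>T T' T''. covering T \<and> covering T' \<and> covering T'' \<and> dim T = t + 1 \<and> dim T' = t + 1
      \<and> dim T'' = t + 1 \<and> T \<noteq> T' \<and> \<not> T \<inter> T' \<subseteq> T''")
    case True
    then obtain Z where Z: "subspace Z" "dim Z = t + 2" "dim (Z \<inter> W) \<le> 1" "\<F> = H3 scale W n t Z"
      using family_eq_H3 by blast
    consider "dim (Z \<inter> W) = 0" | "dim (Z \<inter> W) = 1" using Z(3) by linarith
    then show ?thesis
    proof cases
      case 1
      have "n \<le> 2 * t + 2"
        using card_H3_le[OF Z(1,2)] H3_type_0_less_threshold[OF t_ge_1 t_le range] size Z(4)
        by force
      moreover have "has_type scale W (t + 2) 0 Z" unfolding has_type_def using Z 1 by blast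
      ultimately show ?thesis using Z(4) by blast
    next
      case 2
      have "n \<le> 2 * t + 1"
        using card_H3_type_1_le[OF Z(1,2) 2] H3_type_1_less_threshold[OF t_ge_1 t_le range] size Z(4)
        by force
      moreover have "has_type scale W (t + 2) 1 Z" unfolding has_type_def using Z 2 by blast
      ultimately show ?thesis using Z(4) by blast
    qed
  next
    case no_triangle: False
    \<comment> \<open>Two distinct covering \<open>(t + 1)\<close>-spaces determine \<open>X\<close>
      as their intersection; if \<open>T1\<close> is the only one, any \<open>t\<close>-subspace of
      it serves.\<close>
    obtain X where X: "subspace X" "dim X = t" "\<And>T. covering T \<Longrightarrow> dim T = t + 1 \<Longrightarrow> X \<subseteq> T"
    proof (cases "\<exists>T. covering T \<and> dim T = t + 1 \<and> T \<noteq> T1")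
      case True
      then obtain T where T: "covering T" "dim T = t + 1" "T1 \<noteq> T" by blast
      show ?thesis
      proof (rule that[of "T1 \<inter> T"])
        show "subspace (T1 \<inter> T)" using T1 T covering_subspace by (intro subspace_inter) auto
        show "dim (T1 \<inter> T) = t" by (rule coverings_dim_Int[OF T1(1) T(1) dT1 T(2,3)])
        show "T1 \<inter> T \<subseteq> T'" if "covering T'" "dim T' = t + 1" for T'
          using no_triangle T1(1) dT1 T that by blast
      qed
    next
      case False
      obtain X where "subspace X" "X \<subseteq> span T1" "dim X = t"
        using choose_subspace_of_subspace[of t T1] dT1 by auto
      then show ?thesis
        using that[of X] False span_eq_iff[THEN iffD2, OF covering_subspace[OF T1(1)]] by auto
    qed
    have XT1: "X \<subseteq> T1" by (rule X(3)[OF T1(1) dT1])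
    have trX: "transversal X"
      using transversal_subset[OF _ X(1) XT1] T1(1) by (simp add: covering_def)
    define D where "D = \<Inter>{span (X \<union> F) | F. F \<in> \<F> \<and> \<not> X \<subseteq> F}"
    have sD: "subspace D" unfolding D_def by (rule subspace_Inter) auto
    have XD: "X \<subseteq> D" unfolding D_def using span_superset by blast
    have TD: "T \<subseteq> D" if "covering T" "dim T = t + 1" for T
      unfolding D_def using meets_center[OF that X(3)[OF that] X(1,2)] by blast
    have "n \<le> dim D"
    proof (rule ccontr)
      assume "\<not> n \<le> dim D"
      then have "dim D \<le> n - 1" by simp
      then have "real (card \<F>) \<le> proj_points Q (n - t - 1) * Q ^ (l * (n - t - 1))
          + proj_points Q (t + 1) * (Q * proj_points Q (n - t) * (Q ^ 2 * proj_points Q (n - t - 1) * Q ^ (l * (n - t - 2))))"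
        using X(3) TD by (intro card_le_few_covers[OF T1(1) dT1 _ X(1,2) sD]) auto
      then show False
        using few_covers_less_threshold[OF t_ge_1 t_le range] size by linarith
    qed
    then obtain M where M: "subspace M" "X \<subseteq> M" "M \<subseteq> D" "dim M = n"
      using subspace_between[OF X(1) sD XD] X(2) t_le by (metis add_leD1)
    \<comment> \<open>The dimension comes from the covering space \<open>T1\<close>, the inclusion
      from \<open>M \<subseteq> D\<close>.\<close>
    have "dim (F \<inter> X) = t - 1 \<and> M \<subseteq> span (X \<union> F)" if "F \<in> \<F>" "\<not> X \<subseteq> F" for F
      using meets_center[OF T1(1) dT1 XT1 X(1,2) that] M(3) that unfolding D_def by blast
    from family_eq_H2[OF trX X(2) M(1,4,2) this] obtain C k c where
      "has_type scale W n k M" "has_type scale W c (c - n) C" "M \<subseteq> C" "k \<in> {0, 1}"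
      "c \<in> {n + 1..2 * n - t} \<union> {n + l}" "\<F> = H2 scale W n t X M C" by blast
    moreover have "has_type scale W t 0 X" using has_type_0_iff trX X(2) by blast
    ultimately show ?thesis using M(2) by blast
  qed
qed

end

theorem theorem1p1:
  fixes scale :: "'a::{field,finite} \<Rightarrow> 'b::ab_group_add \<Rightarrow> 'b"
    and W :: "'b set" and \<F> :: "'b set set" and n l t q :: nat
  assumes "vector_space scale"
    and "q = CARD('a)"
    and "vector_space.dim scale (UNIV :: 'b set) = n + l"
    and "module.subspace scale W"
    and "vector_space.dim scale W = l"
    and "1 \<le> t" and "t + 2 \<le> n" and "n + t + 2 \<le> l"
    and "(l, q) \<noteq> (n + t + 2, 2)" and "(l, q) \<noteq> (n + t + 3, 2)"
    and "\<F> \<subseteq> typed_subspaces scale W UNIV n 0"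
    and "t_intersecting scale t \<F>"
    and "non_trivial scale t \<F>"
    and "maximal_family scale W n t \<F>"
    and "real (card \<F>) \<ge>
           real q ^ (l * (n - t - 1) + 1) * theta q (int n - int t - 1)
         - real q ^ (l * (n - t - 2) + 3) * gauss_binom q (int n - int t - 1) 2"
  shows
    "(\<exists>X M C k c. has_type scale W t 0 X
        \<and> has_type scale W n k M
        \<and> has_type scale W c (c - n) C
        \<and> X \<subseteq> M \<and> M \<subseteq> C
        \<and> k \<in> {0, 1} \<and> c \<in> {n + 1..2 * n - t} \<union> {n + l}
        \<and> \<F> = H2 scale W n t X M C)
   \<or> (\<exists>Z. has_type scale W (t + 2) 0 Z
        \<and> \<F> = H3 scale W n t Z
        \<and> real n / 2 - 1 \<le> real t \<and> t \<le> n - 2)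
   \<or> (\<exists>Z. has_type scale W (t + 2) 1 Z
        \<and> \<F> = H3 scale W n t Z
        \<and> real n / 2 - 1 / 2 \<le> real t \<and> t \<le> n - 2)"
proof -
  interpret vs: vector_space scale by fact
  obtain B where B: "vs.independent B" "UNIV \<subseteq> vs.span B" "card B = vs.dim UNIV"
    using vs.basis_exists[of UNIV] by blast
  \<comment> \<open>Infinite sets have \<open>card\<close> 0, whereas \<open>card B = n + l\<close>
    is positive.\<close>
  have "finite B" using B(3) assms(3,7) by (intro card_ge_0_finite) simp
  interpret maximal_intersecting_family scale B q W n l t \<F>
  proof
    show "vs.span B = UNIV" using B(2) by blast
    show "A \<in> \<F>" if A: "A \<in> typed_subspaces scale W UNIV n 0" "\<And>F. F \<in> \<F> \<Longrightarrow> t \<le> vs.dim (F \<inter> A)" for A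
    proof (rule ccontr)
      assume "A \<notin> \<F>"
      \<comment> \<open>\<open>t_intersecting\<close> also tests \<open>A\<close> against itself,
        which succeeds because \<open>t \<le> n\<close>.\<close>
      moreover have "vs.dim (A \<inter> A) = n" using A(1) by (simp add: typed_subspaces_def has_type_def)
      then have "t_intersecting scale t (\<F> \<union> {A})"
        using assms(7,12) A(2) unfolding t_intersecting_def by (auto simp: Int_commute)
      ultimately show False using assms(14) A(1) unfolding maximal_family_def by blast
    qed
  qed (use assms B \<open>finite B\<close> in \<open>auto simp: t_intersecting_def non_trivial_def\<close>)
  \<comment> \<open>For \<open>q = 2\<close> the two excluded pairs raise the lower bound on
    \<open>l\<close> by 2, as the numerical estimates require.\<close>
  have range: "real q = 2 \<and> n + t + 4 \<le> l \<or> real q \<ge> 3 \<and> n + t + 2 \<le> l"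
  proof (cases "q = 2")
    case True
    then have "l \<noteq> n + t + 2" "l \<noteq> n + t + 3" using assms(9,10) by auto
    then show ?thesis using True assms(8) by auto
  next
    case False
    then show ?thesis using q_ge_2 assms(8) by auto
  qed
  have "size_threshold (real q) l (n - t - 1) \<le> real (card \<F>)"
    using assms(15) unfolding size_threshold_conv_gauss_binom[OF q_ge_2 assms(7)] .
  from large_family_cases[OF range this] show ?thesis
  proof (elim disjE exE conjE, goal_cases)
    case 1
    then show ?case by blast
  next
    case (2 Z)
    then have "real n / 2 - 1 \<le> real t" "t \<le> n - 2" using assms(7) by auto
    with 2 show ?case by blast
  next
    case (3 Z)
    then have "real n / 2 - 1 / 2 \<le> real t" "t \<le> n - 2" using assms(7) by auto
    with 3 show ?case by blast
  qed
qed

end
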